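(* Let $\lambda,\alpha\in\mathbb{C}^*$ and $a\in\mathbb{C}$. Then the following statements hold. (1) As a module over the Ramond $N=1$ algebra $\mathscr{R}$, $S(\lambda,\alpha,a)\cong\Omega_{\mathscr{R}}(\lambda,-\frac12 a)$. (2) As a module over the Neveu-Schwarz $N=1$ algebra $\mathscr{NS}$, $S(\lambda,\alpha,a)\cong\Omega_{\mathscr{NS}}(\lambda^2,-\frac12 a)$.
   Context: The base field is $\mathbb{C}$; $\mathbb{C}^*$ is the set of nonzero complex numbers. Modules over Lie superalgebras are supermodules ($\mathbb{Z}_2$-graded, with the action compatible with the grading). The Ramond $N=2$ superconformal algebra $\mathcal{R}$ is the Lie superalgebra with basis $\{L_m,H_m,G_m^{+},G_m^{-},C\mid m\in\mathbb{Z}\}$, where $L_m,H_m,C$ are even, $G_m^{\pm}$ are odd, and, for $m,n,r,s\in\mathbb{Z}$, $[L_m,L_n]=(m-n)L_{m+n}+\frac1{12}(m^3-m)\delta_{m+n,0}C$, $[L_m,H_n]=-nH_{m+n}$, $[H_m,H_n]=\frac13 m\delta_{m+n,0}C$, $[L_m,G_r^{\pm}]=(\frac12 m-r)G_{m+r}^{\pm}$, $[H_m,G_r^{\pm}]=\pm G_{m+r}^{\pm}$, $[G_r^-,G_s^+]=2L_{r+s}-(r-s)H_{r+s}+\frac13(r^2-\frac14)\delta_{r+s,0}C$, $[G_r^+,G_s^+]=[G_r^-,G_s^-]=0$, $[\mathcal{R},C]=0$. The (centerless) $N=1$ superconformal algebra for $\epsilon\in\{0,\frac12\}$ is the Lie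 superalgebra with even basis $\{\mathbb{L}_n\mid n\in\mathbb{Z}\}$, odd basis $\{\mathbb{G}_r\mid r\in\epsilon+\mathbb{Z}\}$ and relations $[\mathbb{L}_m,\mathbb{L}_n]=(m-n)\mathbb{L}_{m+n}$, $[\mathbb{L}_m,\mathbb{G}_r]=(\frac12 m-r)\mathbb{G}_{m+r}$, $[\mathbb{G}_r,\mathbb{G}_s]=2\mathbb{L}_{r+s}$. For $\epsilon=0$ it is the Ramond algebra $\mathscr{R}$; for $\epsilon=\frac12$ it is the Neveu-Schwarz algebra $\mathscr{NS}$. There are injective Lie superalgebra homomorphisms $\Upsilon_1:\mathscr{NS}\to\mathscr{R}$, $\mathbb{L}_m\mapsto\frac12\mathbb{L}_{2m}$ $(m\in\mathbb{Z})$, $\mathbb{G}_r\mapsto\frac1{\sqrt2}\mathbb{G}_{2r}$ $(r\in\frac12+\mathbb{Z})$, and $\Upsilon_2:\mathscr{R}\to\mathcal{R}/\mathbb{C}C$, $\mathbb{L}_m\mapsto L_m$, $\mathbb{G}_m\mapsto\frac1{\sqrt2}(G_m^++G_m^-)$. Any $\mathcal{R}$-module on which $C$ acts as zero is regarded as an $\mathscr{R}$-module via $\Upsilon_2$ and as an $\mathscr{NS}$-module via $\Upsilon_2\circ\Upsilon_1$. For $\lambda,\alpha\in\mathbb{C}^*$ and $a\in\mathbb{C}$, $S(\lambda,\alpha,a)=\mathbb{C}[x]\oplus\mathbb{C}[s]$ is the $\mathcal{R}$-module with even part $\mathbb{C}[x]$, odd part $\mathbb{C}[s]$ and action: $L_m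 f(x)=\lambda^m(x-\frac12 ma)f(x+m)$, $L_m g(s)=\lambda^m(s-\frac12 ma+\frac12 m)g(s+m)$, $H_m f(x)=-a\lambda^m f(x+m)$, $H_m g(s)=-(a+1)\lambda^m g(s+m)$, $G_m^+f(x)=0$, $G_m^+g(s)=\lambda^m\frac2\alpha(x-ma)g(x+m)$, $G_m^-f(x)=\lambda^m\alpha f(s+m)$, $G_m^-g(s)=0$, $Cf=Cg=0$. For $\lambda\in\mathbb{C}^*$, $c\in\mathbb{C}$, $\Omega_{\mathscr{R}}(\lambda,c)=\mathbb{C}[x^2]\oplus x\mathbb{C}[x^2]$ (even part $\mathbb{C}[x^2]$, odd part $x\mathbb{C}[x^2]$) is the $\mathscr{R}$-module with, for $m\in\mathbb{Z}$: $\mathbb{L}_m f(x^2)=\lambda^m(x^2+mc)f(x^2+m)$, $\mathbb{L}_m\,xf(x^2)=\lambda^m x\,(x^2+m(c+\frac12))f(x^2+m)$, $\mathbb{G}_m f(x^2)=\lambda^m xf(x^2+m)$, $\mathbb{G}_m\,xf(x^2)=\lambda^m(x^2+2mc)f(x^2+m)$. For $\lambda\in\mathbb{C}^*$, $c\in\mathbb{C}$, $\Omega_{\mathscr{NS}}(\lambda,c)=\mathbb{C}[x]\oplus\mathbb{C}[y]$ (even part $\mathbb{C}[x]$, odd part $\mathbb{C}[y]$) is the $\mathscr{NS}$-module with, for $m\in\mathbb{Z}$, $r\in\frac12+\mathbb{Z}$: $\mathbb{L}_m f(x)=\lambda^m(x+mc)f(x+m)$, $\mathbb{L}_m g(y)=\lambda^m(y+m(c+\frac12))g(y+m)$,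 $\mathbb{G}_r f(x)=\lambda^{r-\frac12}f(y+r)$, $\mathbb{G}_r g(y)=\lambda^{r+\frac12}(x+2rc)g(x+r)$. *)

theory Defs
  imports
    Complex_Main
    "HOL-Library.Poly_Mapping"
    "HOL-Library.Product_Plus"
    "HOL-Computational_Algebra.Polynomial"
begin

section \<open>Superspaces, Lie superalgebras, supermodules\<close>

text \<open>A complex superspace lives inside an ambient complex vector space \<open>'v\<close> and is the sum of
  its even and odd part; the ambient space may be larger.  Parities are booleans: odd is
  \<^const>\<open>True\<close>, so the sum of the parities \<open>p\<close> and \<open>q\<close> is \<open>p \<noteq> q\<close>.\<close>

record 'v superspace =
  scale :: "complex \<Rightarrow> 'v \<Rightarrow> 'v"
  even_part :: "'v set"
  odd_part :: "'v set"

record 'g lie_superalgebra = "'g superspace" +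
  bracket :: "'g \<Rightarrow> 'g \<Rightarrow> 'g"

record ('g, 'v) supermodule = "'v superspace" +
  act :: "'g \<Rightarrow> 'v \<Rightarrow> 'v"

definition part :: "('v, 'm) superspace_scheme \<Rightarrow> bool \<Rightarrow> 'v set" where
  "part V p = (if p then odd_part V else even_part V)"

definition space :: "('v::ab_group_add, 'm) superspace_scheme \<Rightarrow> 'v set" where
  "space V = {u + w | u w. u \<in> even_part V \<and> w \<in> odd_part V}"

definition sgn_rule :: "bool \<Rightarrow> bool \<Rightarrow> complex" where
  "sgn_rule p q = (if p \<and> q then - 1 else 1)"

definition is_superspace :: "('v::ab_group_add, 'm) superspace_scheme \<Rightarrow> bool" where
  "is_superspace V \<longleftrightarrow>
     vector_space (scale V) \<and>
     module.subspace (scale V) (even_part V) \<and>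
     module.subspace (scale V) (odd_part V) \<and>
     even_part V \<inter> odd_part V = {0}"

definition linear_between ::
    "('v::ab_group_add, 'm) superspace_scheme \<Rightarrow> ('w::ab_group_add, 'n) superspace_scheme
      \<Rightarrow> ('v \<Rightarrow> 'w) \<Rightarrow> bool" where
  "linear_between V W f \<longleftrightarrow>
     (\<forall>u\<in>space V. \<forall>v\<in>space V. f (u + v) = f u + f v) \<and>
     (\<forall>c. \<forall>v\<in>space V. f (scale V c v) = scale W c (f v))"

definition is_lie_superalgebra :: "('g::ab_group_add, 'm) lie_superalgebra_scheme \<Rightarrow> bool" where
  "is_lie_superalgebra G \<longleftrightarrow>
     is_superspace G \<and>
     (\<forall>x\<in>space G. linear_between G G (bracket G x) \<and> linear_between G G (\<lambda>y. bracket G y x)) \<and>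
     (\<forall>p q. \<forall>x\<in>part G p. \<forall>y\<in>part G q. bracket G x y \<in> part G (p \<noteq> q)) \<and>
     (\<forall>p q. \<forall>x\<in>part G p. \<forall>y\<in>part G q.
        bracket G y x = - scale G (sgn_rule p q) (bracket G x y)) \<and>
     (\<forall>p q. \<forall>x\<in>part G p. \<forall>y\<in>part G q. \<forall>z\<in>space G.
        bracket G x (bracket G y z) =
        bracket G (bracket G x y) z + scale G (sgn_rule p q) (bracket G y (bracket G x z)))"

definition is_supermodule ::
    "('g::ab_group_add, 'm) lie_superalgebra_scheme \<Rightarrow> ('g, 'v::ab_group_add, 'n) supermodule_scheme
      \<Rightarrow> bool" where
  "is_supermodule G M \<longleftrightarrow>
     is_lie_superalgebra G \<and>
     is_superspace M \<and>
     (\<forall>x\<in>space G. linear_between M M (act M x)) \<and>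
     (\<forall>v\<in>space M. linear_between G M (\<lambda>x. act M x v)) \<and>
     (\<forall>p q. \<forall>x\<in>part G p. \<forall>v\<in>part M q. act M x v \<in> part M (p \<noteq> q)) \<and>
     (\<forall>p q. \<forall>x\<in>part G p. \<forall>y\<in>part G q. \<forall>v\<in>space M.
        act M (bracket G x y) v =
        act M x (act M y v) - scale M (sgn_rule p q) (act M y (act M x v)))"

text \<open>Isomorphisms are parity-preserving, and both sides are required to be supermodules.\<close>

definition supermodule_iso ::
    "('g::ab_group_add, 'm) lie_superalgebra_scheme \<Rightarrow> ('g, 'v::ab_group_add, 'k) supermodule_scheme
      \<Rightarrow> ('g, 'w::ab_group_add, 'l) supermodule_scheme \<Rightarrow> ('v \<Rightarrow> 'w) \<Rightarrow> bool" where
  "supermodule_iso G M N f \<longleftrightarrow>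
     is_supermodule G M \<and>
     is_supermodule G N \<and>
     linear_between M N f \<and>
     bij_betw f (space M) (space N) \<and>
     (\<forall>p. f ` part M p \<subseteq> part N p) \<and>
     (\<forall>x\<in>space G. \<forall>v\<in>space M. f (act M x v) = act N x (f v))"

definition isomorphic_supermodules ::
    "('g::ab_group_add, 'm) lie_superalgebra_scheme \<Rightarrow> ('g, 'v::ab_group_add, 'k) supermodule_scheme
      \<Rightarrow> ('g, 'w::ab_group_add, 'l) supermodule_scheme \<Rightarrow> bool" where
  "isomorphic_supermodules G M N \<longleftrightarrow> (\<exists>f. supermodule_iso G M N f)"

definition pullback :: "('h \<Rightarrow> 'g) \<Rightarrow> ('g, 'v) supermodule \<Rightarrow> ('h, 'v) supermodule" where
  "pullback f M =
     \<lparr>scale = scale M, even_part = even_part M, odd_part = odd_part M, act = (\<lambda>x. act M (f x))\<rparr>"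


section \<open>Lie superalgebras given by a basis\<close>

definition fscale :: "complex \<Rightarrow> ('b \<Rightarrow>\<^sub>0 complex) \<Rightarrow> ('b \<Rightarrow>\<^sub>0 complex)" where
  "fscale c x = Poly_Mapping.map ((*) c) x"

definition lin_ext :: "(complex \<Rightarrow> 'v \<Rightarrow> 'v) \<Rightarrow> ('b \<Rightarrow> 'v::ab_group_add) \<Rightarrow> ('b \<Rightarrow>\<^sub>0 complex) \<Rightarrow> 'v" where
  "lin_ext sc f x = (\<Sum>b\<in>Poly_Mapping.keys x. sc (Poly_Mapping.lookup x b) (f b))"

definition based_superalgebra ::
    "'b set \<Rightarrow> 'b set \<Rightarrow> ('b \<Rightarrow> 'b \<Rightarrow> ('b \<Rightarrow>\<^sub>0 complex)) \<Rightarrow> ('b \<Rightarrow>\<^sub>0 complex) lie_superalgebra" where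
  "based_superalgebra B0 B1 br =
     \<lparr>scale = fscale,
      even_part = {x. Poly_Mapping.keys x \<subseteq> B0},
      odd_part = {x. Poly_Mapping.keys x \<subseteq> B1},
      bracket = (\<lambda>x y. lin_ext fscale (\<lambda>b. lin_ext fscale (br b) y) x)\<rparr>"


subsection \<open>The Ramond \<open>N = 2\<close> superconformal algebra\<close>

datatype n2_basis = L int | H int | Gp int | Gm int | C

fun n2_bracket :: "n2_basis \<Rightarrow> n2_basis \<Rightarrow> (n2_basis \<Rightarrow>\<^sub>0 complex)" where
  "n2_bracket (L m) (L n) =
     Poly_Mapping.single (L (m + n)) (of_int (m - n)) +
     (if m + n = 0 then Poly_Mapping.single C (1/12 * of_int (m ^ 3 - m)) else 0)"
| "n2_bracket (L m) (H n) = Poly_Mapping.single (H (m + n)) (- of_int n)"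
| "n2_bracket (H n) (L m) = Poly_Mapping.single (H (m + n)) (of_int n)"
| "n2_bracket (H m) (H n) = (if m + n = 0 then Poly_Mapping.single C (1/3 * of_int m) else 0)"
| "n2_bracket (L m) (Gp r) = Poly_Mapping.single (Gp (m + r)) (1/2 * of_int m - of_int r)"
| "n2_bracket (L m) (Gm r) = Poly_Mapping.single (Gm (m + r)) (1/2 * of_int m - of_int r)"
| "n2_bracket (Gp r) (L m) = Poly_Mapping.single (Gp (m + r)) (- (1/2 * of_int m - of_int r))"
| "n2_bracket (Gm r) (L m) = Poly_Mapping.single (Gm (m + r)) (- (1/2 * of_int m - of_int r))"
| "n2_bracket (H m) (Gp r) = Poly_Mapping.single (Gp (m + r)) 1"
| "n2_bracket (H m) (Gm r) = Poly_Mapping.single (Gm (m + r)) (- 1)"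
| "n2_bracket (Gp r) (H m) = Poly_Mapping.single (Gp (m + r)) (- 1)"
| "n2_bracket (Gm r) (H m) = Poly_Mapping.single (Gm (m + r)) 1"
| "n2_bracket (Gm r) (Gp s) =
     Poly_Mapping.single (L (r + s)) 2 - Poly_Mapping.single (H (r + s)) (of_int (r - s)) +
     (if r + s = 0 then Poly_Mapping.single C (1/3 * ((of_int r)\<^sup>2 - 1/4)) else 0)"
| "n2_bracket (Gp s) (Gm r) =
     Poly_Mapping.single (L (r + s)) 2 - Poly_Mapping.single (H (r + s)) (of_int (r - s)) +
     (if r + s = 0 then Poly_Mapping.single C (1/3 * ((of_int r)\<^sup>2 - 1/4)) else 0)"
| "n2_bracket (Gp r) (Gp s) = 0"
| "n2_bracket (Gm r) (Gm s) = 0"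
| "n2_bracket C x = 0"
| "n2_bracket x C = 0"

definition n2_algebra :: "(n2_basis \<Rightarrow>\<^sub>0 complex) lie_superalgebra" where
  "n2_algebra = based_superalgebra (range L \<union> range H \<union> {C}) (range Gp \<union> range Gm) n2_bracket"


subsection \<open>The \<open>N = 1\<close> superconformal algebras\<close>

text \<open>The index of \<open>GG r\<close> is a rational number; only \<open>r \<in> \<epsilon> + \<int>\<close> with \<open>\<epsilon> \<in> {0, 1/2}\<close> occurs in
  the algebra with parameter \<open>\<epsilon>\<close>, so that \<open>r + s\<close> below is always an integer.\<close>

datatype n1_basis = LL int | GG rat

fun n1_bracket :: "n1_basis \<Rightarrow> n1_basis \<Rightarrow> (n1_basis \<Rightarrow>\<^sub>0 complex)" where
  "n1_bracket (LL m) (LL n) = Poly_Mapping.single (LL (m + n)) (of_int (m - n))"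
| "n1_bracket (LL m) (GG r) = Poly_Mapping.single (GG (of_int m + r)) (1/2 * of_int m - of_rat r)"
| "n1_bracket (GG r) (LL m) = Poly_Mapping.single (GG (of_int m + r)) (- (1/2 * of_int m - of_rat r))"
| "n1_bracket (GG r) (GG s) = Poly_Mapping.single (LL \<lfloor>r + s\<rfloor>) 2"

definition n1_algebra :: "rat \<Rightarrow> (n1_basis \<Rightarrow>\<^sub>0 complex) lie_superalgebra" where
  "n1_algebra \<epsilon> = based_superalgebra (range LL) (GG ` {\<epsilon> + of_int k | k. True}) n1_bracket"

definition ramond_n1 :: "(n1_basis \<Rightarrow>\<^sub>0 complex) lie_superalgebra" where
  "ramond_n1 = n1_algebra 0"

definition neveu_schwarz_n1 :: "(n1_basis \<Rightarrow>\<^sub>0 complex) lie_superalgebra" where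
  "neveu_schwarz_n1 = n1_algebra (1/2)"


subsection \<open>The quotient of the Ramond \<open>N = 2\<close> algebra by \<open>\<complex>C\<close>\<close>

lemma fscale_lookup [simp]: "Poly_Mapping.lookup (fscale c x) b = c * Poly_Mapping.lookup x b"
  unfolding fscale_def by (simp add: Poly_Mapping.map.rep_eq when_def)

lemma vector_space_fscale: "vector_space fscale"
  by unfold_locales (auto intro!: poly_mapping_eqI simp: lookup_add algebra_simps)

lemma fscale_single [simp]: "fscale c (Poly_Mapping.single b d) = Poly_Mapping.single b (c * d)"
  by (rule poly_mapping_eqI) (simp add: lookup_single when_def)

lemma lin_ext_cover:
  assumes "vector_space sc" "finite B" "Poly_Mapping.keys x \<subseteq> B"
  shows "lin_ext sc f x = (\<Sum>b\<in>B. sc (Poly_Mapping.lookup x b) (f b))"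
proof -
  interpret vector_space sc by fact
  show ?thesis unfolding lin_ext_def
    by (rule sum.mono_neutral_left) (use assms in \<open>auto simp: in_keys_iff\<close>)
qed

lemma lin_ext_0 [simp]: "lin_ext sc f 0 = 0"
  by (simp add: lin_ext_def)

lemma lin_ext_single [simp]:
  assumes "vector_space sc"
  shows "lin_ext sc f (Poly_Mapping.single b c) = sc c (f b)"
  using lin_ext_cover[OF assms, of "{b}" "Poly_Mapping.single b c" f] by simp

lemma lin_ext_add:
  assumes "vector_space sc"
  shows "lin_ext sc f (x + y) = lin_ext sc f x + lin_ext sc f y"
proof -
  interpret vector_space sc by fact
  let ?B = "Poly_Mapping.keys x \<union> Poly_Mapping.keys y"
  have "Poly_Mapping.keys (x + y) \<subseteq> ?B" by (rule keys_add)
  then show ?thesis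
    by (simp add: lin_ext_cover[OF assms, of ?B] lookup_add scale_left_distrib sum.distrib)
qed

lemma lin_ext_fscale:
  assumes "vector_space sc"
  shows "lin_ext sc f (fscale c x) = sc c (lin_ext sc f x)"
proof -
  interpret vector_space sc by fact
  have "Poly_Mapping.keys (fscale c x) \<subseteq> Poly_Mapping.keys x" by (auto simp: in_keys_iff)
  then show ?thesis
    by (simp add: lin_ext_cover[OF assms, of "Poly_Mapping.keys x"] scale_sum_right)
qed

lemma lin_ext_uminus:
  assumes "vector_space sc"
  shows "lin_ext sc f (- x) = - lin_ext sc f x"
  using lin_ext_add[OF assms, of f x "- x"] by (simp add: eq_neg_iff_add_eq_0 add.commute)

lemma lin_ext_diff:
  assumes "vector_space sc"
  shows "lin_ext sc f (x - y) = lin_ext sc f x - lin_ext sc f y"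
  using lin_ext_add[OF assms, of f x "- y"] by (simp add: lin_ext_uminus[OF assms])

lemma n2_bracket_C_right [simp]: "n2_bracket x C = 0"
  by (cases x) auto

lemma lin_ext_zero_fun [simp]:
  assumes "vector_space sc"
  shows "lin_ext sc (\<lambda>b. 0) x = 0"
proof -
  interpret vector_space sc by fact
  show ?thesis by (simp add: lin_ext_def)
qed

lemma n2_central:
  "bracket n2_algebra (Poly_Mapping.single C c) y = 0"
  "bracket n2_algebra x (Poly_Mapping.single C c) = 0"
proof -
  interpret vector_space fscale by (rule vector_space_fscale)
  have "n2_bracket C = (\<lambda>_. 0)" by auto
  then show "bracket n2_algebra (Poly_Mapping.single C c) y = 0"
    by (simp add: n2_algebra_def based_superalgebra_def vector_space_fscale)
  show "bracket n2_algebra x (Poly_Mapping.single C c) = 0"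
    by (simp add: n2_algebra_def based_superalgebra_def vector_space_fscale)
qed

lemma lin_ext_add_fun:
  assumes "vector_space sc"
  shows "lin_ext sc (\<lambda>b. f b + g b) x = lin_ext sc f x + lin_ext sc g x"
proof -
  interpret vector_space sc by fact
  show ?thesis by (simp add: lin_ext_def scale_right_distrib sum.distrib)
qed

lemma lin_ext_scale_fun:
  assumes "vector_space sc"
  shows "lin_ext sc (\<lambda>b. sc c (f b)) x = sc c (lin_ext sc f x)"
proof -
  interpret vector_space sc by fact
  show ?thesis by (simp add: lin_ext_def scale_sum_right mult.commute)
qed

lemma based_bracket_add:
  "bracket (based_superalgebra B0 B1 br) (x + x') y =
     bracket (based_superalgebra B0 B1 br) x y + bracket (based_superalgebra B0 B1 br) x' y"
  "bracket (based_superalgebra B0 B1 br) x (y + y') =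
     bracket (based_superalgebra B0 B1 br) x y + bracket (based_superalgebra B0 B1 br) x y'"
  by (simp_all add: based_superalgebra_def lin_ext_add lin_ext_add_fun vector_space_fscale)

lemma based_bracket_scale:
  "bracket (based_superalgebra B0 B1 br) (fscale c x) y =
     fscale c (bracket (based_superalgebra B0 B1 br) x y)"
  "bracket (based_superalgebra B0 B1 br) x (fscale c y) =
     fscale c (bracket (based_superalgebra B0 B1 br) x y)"
  by (simp_all add: based_superalgebra_def lin_ext_fscale vector_space_fscale
    lin_ext_scale_fun[OF vector_space_fscale])

quotient_type n2_mod_C = "n2_basis \<Rightarrow>\<^sub>0 complex" /
    "\<lambda>x y. \<exists>c. x - y = Poly_Mapping.single C c"
proof (rule equivpI)
  show "reflp (\<lambda>x y :: n2_basis \<Rightarrow>\<^sub>0 complex. \<exists>c. x - y = Poly_Mapping.single C c)"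
    by (rule reflpI) (auto intro: exI[of _ 0])
  show "symp (\<lambda>x y :: n2_basis \<Rightarrow>\<^sub>0 complex. \<exists>c. x - y = Poly_Mapping.single C c)"
    by (rule sympI) (metis minus_diff_eq single_uminus)
  show "transp (\<lambda>x y :: n2_basis \<Rightarrow>\<^sub>0 complex. \<exists>c. x - y = Poly_Mapping.single C c)"
  proof (rule transpI)
    fix x y z :: "n2_basis \<Rightarrow>\<^sub>0 complex"
    assume "\<exists>c. x - y = Poly_Mapping.single C c" "\<exists>c. y - z = Poly_Mapping.single C c"
    then obtain c d where "x - y = Poly_Mapping.single C c" "y - z = Poly_Mapping.single C d"
      by blast
    then have "x - z = Poly_Mapping.single C (c + d)"
      by (metis diff_add_cancel add_diff_eq single_add)
    then show "\<exists>c. x - z = Poly_Mapping.single C c" by blast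
  qed
qed

instantiation n2_mod_C :: ab_group_add
begin

lift_definition zero_n2_mod_C :: n2_mod_C is 0 .

lift_definition plus_n2_mod_C :: "n2_mod_C \<Rightarrow> n2_mod_C \<Rightarrow> n2_mod_C" is "(+)"
  by (metis add_diff_add single_add)

lift_definition minus_n2_mod_C :: "n2_mod_C \<Rightarrow> n2_mod_C \<Rightarrow> n2_mod_C" is "(-)"
proof -
  fix x x' y y' :: "n2_basis \<Rightarrow>\<^sub>0 complex"
  assume "\<exists>c. x - x' = Poly_Mapping.single C c" "\<exists>c. y - y' = Poly_Mapping.single C c"
  then obtain c d where "x - x' = Poly_Mapping.single C c" "y - y' = Poly_Mapping.single C d"
    by blast
  moreover have "x - y - (x' - y') = (x - x') - (y - y')" by simp
  ultimately have "x - y - (x' - y') = Poly_Mapping.single C (c - d)" by (simp add: single_diff)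
  then show "\<exists>c. x - y - (x' - y') = Poly_Mapping.single C c" by blast
qed

lift_definition uminus_n2_mod_C :: "n2_mod_C \<Rightarrow> n2_mod_C" is "uminus"
  by (metis minus_diff_minus single_uminus)

instance
  by standard (transfer; rule exI[of _ 0]; simp add: algebra_simps)+

end

lift_definition n2_mod_C_scale :: "complex \<Rightarrow> n2_mod_C \<Rightarrow> n2_mod_C" is fscale
proof -
  interpret vector_space fscale by (rule vector_space_fscale)
  show "\<exists>e. fscale c x - fscale c y = Poly_Mapping.single C e"
    if "\<exists>d. x - y = Poly_Mapping.single C d" for c :: complex and x y
    using that by (metis scale_right_diff_distrib fscale_single)
qed

lift_definition n2_mod_C_bracket :: "n2_mod_C \<Rightarrow> n2_mod_C \<Rightarrow> n2_mod_C" is "bracket n2_algebra"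
proof -
  fix x x' y y' :: "n2_basis \<Rightarrow>\<^sub>0 complex"
  assume "\<exists>c. x - x' = Poly_Mapping.single C c" "\<exists>c. y - y' = Poly_Mapping.single C c"
  then obtain c d where "x = x' + Poly_Mapping.single C c" "y = y' + Poly_Mapping.single C d"
    by (metis diff_add_cancel add.commute)
  then have "bracket n2_algebra x y = bracket n2_algebra x' y'"
    using n2_central unfolding n2_algebra_def by (simp add: based_bracket_add)
  then show "\<exists>c. bracket n2_algebra x y - bracket n2_algebra x' y' = Poly_Mapping.single C c"
    by (auto intro: exI[of _ 0])
qed

definition n2_mod_C_algebra :: "n2_mod_C lie_superalgebra" where
  "n2_mod_C_algebra =
     \<lparr>scale = n2_mod_C_scale,
      even_part = abs_n2_mod_C ` even_part n2_algebra,
      odd_part = abs_n2_mod_C ` odd_part n2_algebra,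
      bracket = n2_mod_C_bracket\<rparr>"


section \<open>The homomorphisms and the restriction of modules along them\<close>

definition Upsilon1 :: "(n1_basis \<Rightarrow>\<^sub>0 complex) \<Rightarrow> (n1_basis \<Rightarrow>\<^sub>0 complex)" where
  "Upsilon1 = lin_ext fscale (\<lambda>b. case b of
      LL m \<Rightarrow> Poly_Mapping.single (LL (2 * m)) (1/2)
    | GG r \<Rightarrow> Poly_Mapping.single (GG (2 * r)) (1 / of_real (sqrt 2)))"

text \<open>On \<^const>\<open>ramond_n1\<close> the index of \<open>GG r\<close> is an integer and \<open>\<lfloor>r\<rfloor>\<close> merely changes its type.\<close>

definition Upsilon2 :: "(n1_basis \<Rightarrow>\<^sub>0 complex) \<Rightarrow> n2_mod_C" where
  "Upsilon2 = lin_ext n2_mod_C_scale (\<lambda>b. case b of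
      LL m \<Rightarrow> abs_n2_mod_C (Poly_Mapping.single (L m) 1)
    | GG r \<Rightarrow> n2_mod_C_scale (1 / of_real (sqrt 2))
        (abs_n2_mod_C (Poly_Mapping.single (Gp \<lfloor>r\<rfloor>) 1 + Poly_Mapping.single (Gm \<lfloor>r\<rfloor>) 1)))"

text \<open>A module of the \<open>N = 2\<close> algebra as a module of the quotient: a class acts by any of its
  representatives.  This is meaningful only for modules on which \<^const>\<open>C\<close> acts as zero.\<close>

definition mod_C :: "(n2_basis \<Rightarrow>\<^sub>0 complex, 'v) supermodule \<Rightarrow> (n2_mod_C, 'v) supermodule" where
  "mod_C M = pullback rep_n2_mod_C M"

definition as_ramond_module ::
    "(n2_basis \<Rightarrow>\<^sub>0 complex, 'v) supermodule \<Rightarrow> (n1_basis \<Rightarrow>\<^sub>0 complex, 'v) supermodule" where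
  "as_ramond_module M = pullback Upsilon2 (mod_C M)"

definition as_neveu_schwarz_module ::
    "(n2_basis \<Rightarrow>\<^sub>0 complex, 'v) supermodule \<Rightarrow> (n1_basis \<Rightarrow>\<^sub>0 complex, 'v) supermodule" where
  "as_neveu_schwarz_module M = pullback (Upsilon2 \<circ> Upsilon1) (mod_C M)"


section \<open>The modules\<close>

definition shift :: "complex \<Rightarrow> complex poly \<Rightarrow> complex poly" where
  "shift c f = f \<circ>\<^sub>p [:c, 1:]"

lemma poly_shift [simp]: "poly (shift c f) z = poly f (z + c)"
  by (simp add: shift_def poly_pcompose add.commute)

definition pair_scale :: "complex \<Rightarrow> complex poly \<times> complex poly \<Rightarrow> complex poly \<times> complex poly" where
  "pair_scale c v = (smult c (fst v), smult c (snd v))"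


subsection \<open>The \<open>N = 2\<close> modules \<open>S(\<lambda>, \<alpha>, a)\<close>\<close>

text \<open>\<open>(f, g)\<close> stands for \<open>f(x) + g(s)\<close>.\<close>

fun S_basis_act ::
    "complex \<Rightarrow> complex \<Rightarrow> complex \<Rightarrow> n2_basis \<Rightarrow> complex poly \<times> complex poly \<Rightarrow> complex poly \<times> complex poly"
where
  "S_basis_act lam \<alpha> a (L m) (f, g) =
     (smult (lam powi m) ([:- (1/2 * of_int m * a), 1:] * shift (of_int m) f),
      smult (lam powi m) ([:- (1/2 * of_int m * a) + 1/2 * of_int m, 1:] * shift (of_int m) g))"
| "S_basis_act lam \<alpha> a (H m) (f, g) =
     (smult (- a * lam powi m) (shift (of_int m) f),
      smult (- (a + 1) * lam powi m) (shift (of_int m) g))"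
| "S_basis_act lam \<alpha> a (Gp m) (f, g) =
     (smult (lam powi m * (2 / \<alpha>)) ([:- (of_int m * a), 1:] * shift (of_int m) g), 0)"
| "S_basis_act lam \<alpha> a (Gm m) (f, g) = (0, smult (lam powi m * \<alpha>) (shift (of_int m) f))"
| "S_basis_act lam \<alpha> a C (f, g) = (0, 0)"

definition S_module ::
    "complex \<Rightarrow> complex \<Rightarrow> complex \<Rightarrow> (n2_basis \<Rightarrow>\<^sub>0 complex, complex poly \<times> complex poly) supermodule" where
  "S_module lam \<alpha> a =
     \<lparr>scale = pair_scale,
      even_part = {(f, 0) | f. True},
      odd_part = {(0, g) | g. True},
      act = (\<lambda>x v. lin_ext pair_scale (\<lambda>b. S_basis_act lam \<alpha> a b v) x)\<rparr>"


subsection \<open>The Ramond modules \<open>\<Omega>(\<lambda>, c)\<close> on \<open>\<complex>[x\<^sup>2] \<oplus> x\<complex>[x\<^sup>2]\<close>\<close>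

definition at_sq :: "complex poly \<Rightarrow> complex poly" where
  "at_sq f = f \<circ>\<^sub>p [:0, 0, 1:]"

text \<open>The unique \<open>f\<close>, \<open>h\<close> with \<open>p = f(x\<^sup>2) + x h(x\<^sup>2)\<close>.\<close>

definition even_coeffs :: "complex poly \<Rightarrow> complex poly" where
  "even_coeffs p = (\<Sum>i\<le>degree p. monom (coeff p (2 * i)) i)"

definition odd_coeffs :: "complex poly \<Rightarrow> complex poly" where
  "odd_coeffs p = (\<Sum>i\<le>degree p. monom (coeff p (2 * i + 1)) i)"

lemma coeff_even_coeffs: "coeff (even_coeffs p) i = coeff p (2 * i)"
  by (auto simp: even_coeffs_def coeff_sum coeff_monom intro!: coeff_eq_0)

lemma coeff_odd_coeffs: "coeff (odd_coeffs p) i = coeff p (2 * i + 1)"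
  by (auto simp: odd_coeffs_def coeff_sum coeff_monom intro!: coeff_eq_0)

lemma coeff_at_sq: "coeff (at_sq f) i = (if even i then coeff f (i div 2) else 0)"
proof (induction f arbitrary: i)
  case 0
  then show ?case by (simp add: at_sq_def)
next
  case (pCons a f)
  have "at_sq (pCons a f) = pCons a (pCons 0 (at_sq f))"
    by (simp add: at_sq_def pcompose_pCons)
  then show ?case
    using pCons.IH[of "i - 2"]
    by (cases i; cases "i - 1") (auto simp: coeff_pCons split: nat.splits)
qed

lemma parity_decomposition: "p = at_sq (even_coeffs p) + [:0, 1:] * at_sq (odd_coeffs p)"
  by (rule poly_eqI)
    (auto simp: coeff_at_sq coeff_even_coeffs coeff_odd_coeffs coeff_pCons elim!: oddE
      split: nat.splits)

lemma even_odd_coeffs [simp]: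
  "even_coeffs (at_sq f + [:0, 1:] * at_sq h) = f"
  "odd_coeffs (at_sq f + [:0, 1:] * at_sq h) = h"
  by (rule poly_eqI,
    simp add: coeff_at_sq coeff_even_coeffs coeff_odd_coeffs coeff_pCons split: nat.splits; presburger)+

fun Omega_R_basis_act :: "complex \<Rightarrow> complex \<Rightarrow> n1_basis \<Rightarrow> complex poly \<Rightarrow> complex poly" where
  "Omega_R_basis_act lam c (LL m) p =
     at_sq (smult (lam powi m) ([:of_int m * c, 1:] * shift (of_int m) (even_coeffs p))) +
     [:0, 1:] * at_sq (smult (lam powi m)
       ([:of_int m * (c + 1/2), 1:] * shift (of_int m) (odd_coeffs p)))"
| "Omega_R_basis_act lam c (GG r) p =
     at_sq (smult (lam powi \<lfloor>r\<rfloor>) ([:2 * of_rat r * c, 1:] * shift (of_rat r) (odd_coeffs p))) +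
     [:0, 1:] * at_sq (smult (lam powi \<lfloor>r\<rfloor>) (shift (of_rat r) (even_coeffs p)))"

definition Omega_R :: "complex \<Rightarrow> complex \<Rightarrow> (n1_basis \<Rightarrow>\<^sub>0 complex, complex poly) supermodule" where
  "Omega_R lam c =
     \<lparr>scale = smult,
      even_part = range at_sq,
      odd_part = {[:0, 1:] * at_sq f | f. True},
      act = (\<lambda>x p. lin_ext smult (\<lambda>b. Omega_R_basis_act lam c b p) x)\<rparr>"


subsection \<open>The Neveu-Schwarz modules \<open>\<Omega>(\<lambda>, c)\<close>\<close>

text \<open>\<open>(f, g)\<close> stands for \<open>f(x) + g(y)\<close>.\<close>

fun Omega_NS_basis_act ::
    "complex \<Rightarrow> complex \<Rightarrow> n1_basis \<Rightarrow> complex poly \<times> complex poly \<Rightarrow> complex poly \<times> complex poly" where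
  "Omega_NS_basis_act lam c (LL m) (f, g) =
     (smult (lam powi m) ([:of_int m * c, 1:] * shift (of_int m) f),
      smult (lam powi m) ([:of_int m * (c + 1/2), 1:] * shift (of_int m) g))"
| "Omega_NS_basis_act lam c (GG r) (f, g) =
     (smult (lam powi \<lfloor>r + 1/2\<rfloor>) ([:2 * of_rat r * c, 1:] * shift (of_rat r) g),
      smult (lam powi \<lfloor>r - 1/2\<rfloor>) (shift (of_rat r) f))"

definition Omega_NS ::
    "complex \<Rightarrow> complex \<Rightarrow> (n1_basis \<Rightarrow>\<^sub>0 complex, complex poly \<times> complex poly) supermodule" where
  "Omega_NS lam c =
     \<lparr>scale = pair_scale,
      even_part = {(f, 0) | f. True},
      odd_part = {(0, g) | g. True},
      act = (\<lambda>x v. lin_ext pair_scale (\<lambda>b. Omega_NS_basis_act lam c b v) x)\<rparr>"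

end

theory Submission
  imports Defs
begin

text \<open>On the even and odd polynomials of \<open>S(\<lambda>, \<alpha>, a)\<close> the isomorphisms are substitutions up to a
  scalar on the odd part: \<open>f(x) + g(s) \<mapsto> f(x\<^sup>2) + (\<surd>2/\<alpha>) x g(x\<^sup>2)\<close> for the Ramond algebra and
  \<open>f(x) + g(s) \<mapsto> f(2x) + (2/(\<lambda>\<alpha>)) g(2y)\<close> for the Neveu-Schwarz algebra. The odd scalars are
  forced by the action of \<open>GG r\<close> on the even part.  The module axioms are checked, on basis elements,
  for a single module \<open>N1_module \<mu> c\<close> covering both algebras, and all the other modules inherit them
  through intertwining bijections.\<close>

section \<open>Finitely supported combinations and their linear extensions\<close>

text \<open>A finitely supported map is the finite sum of its one-term pieces, and each piece is
  indexed by an element of \<open>B\<close>. Hence an additive property has to be checked on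
  multiples of basis elements only.\<close>

lemma poly_mapping_keys_induct [consumes 1, case_names zero single add]:
  fixes x :: "'b \<Rightarrow>\<^sub>0 'c::comm_monoid_add"
  assumes "Poly_Mapping.keys x \<subseteq> B"
    and "P 0"
    and "\<And>b c. b \<in> B \<Longrightarrow> P (Poly_Mapping.single b c)"
    and "\<And>x y. P x \<Longrightarrow> P y \<Longrightarrow> P (x + y)"
  shows "P x"
proof -
  have *: "P (\<Sum>b\<in>A. Poly_Mapping.single b (Poly_Mapping.lookup x b))"
    if "finite A" "A \<subseteq> Poly_Mapping.keys x" for A
    using that
  proof (induction A rule: finite_induct)
    case (insert b A)
    then show ?case
      using assms(1) by (simp add: subset_iff assms(3,4))
  qed (simp add: assms(2))
  have "(\<Sum>b\<in>Poly_Mapping.keys x. Poly_Mapping.single b (Poly_Mapping.lookup x b)) = x"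
    by (rule poly_mapping_eqI)
      (auto simp: lookup_sum lookup_single when_def in_keys_iff sum.delta)
  with *[OF finite_keys order_refl] show ?thesis
    by (simp only:)
qed

lemma lin_ext_map:
  assumes "\<And>u v. f (u + v) = f u + f v" and "\<And>c v. f (sc c v) = sc' c (f v)"
  shows "f (lin_ext sc h x) = lin_ext sc' (\<lambda>b. f (h b)) x"
proof -
  interpret f: additive f by standard (rule assms)
  show ?thesis by (simp add: lin_ext_def f.sum assms(2))
qed

lemma lin_ext_cong:
  assumes "Poly_Mapping.keys x \<subseteq> B" and "\<And>b. b \<in> B \<Longrightarrow> f b = g b"
  shows "lin_ext sc f x = lin_ext sc g x"
  unfolding lin_ext_def using assms by (auto intro!: sum.cong)

section \<open>Superalgebras and supermodules given on a basis\<close>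

lemma based_superalgebra_sel [simp]:
  "scale (based_superalgebra B0 B1 br) = fscale"
  "part (based_superalgebra B0 B1 br) p = {x. Poly_Mapping.keys x \<subseteq> (if p then B1 else B0)}"
  "bracket (based_superalgebra B0 B1 br) =
     (\<lambda>x y. lin_ext fscale (\<lambda>b. lin_ext fscale (br b) y) x)"
  by (simp_all add: based_superalgebra_def part_def)

lemma keys_space_based_superalgebra:
  "x \<in> space (based_superalgebra B0 B1 br) \<Longrightarrow> Poly_Mapping.keys x \<subseteq> B0 \<union> B1"
  using keys_add by (fastforce simp: space_def based_superalgebra_def)

lemma is_superspace_based_superalgebra:
  assumes "B0 \<inter> B1 = {}"
  shows "is_superspace (based_superalgebra B0 B1 br)"
proof -
  interpret vector_space fscale by (rule vector_space_fscale)
  have "subspace {x. Poly_Mapping.keys x \<subseteq> B}" for B :: "'a set"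
  proof (rule subspaceI)
    fix x y :: "'a \<Rightarrow>\<^sub>0 complex"
    show "x + y \<in> {x. Poly_Mapping.keys x \<subseteq> B}"
      if "x \<in> {x. Poly_Mapping.keys x \<subseteq> B}" "y \<in> {x. Poly_Mapping.keys x \<subseteq> B}"
      using that keys_add[of x y] by auto
  next
    fix c and x :: "'a \<Rightarrow>\<^sub>0 complex"
    show "fscale c x \<in> {x. Poly_Mapping.keys x \<subseteq> B}" if "x \<in> {x. Poly_Mapping.keys x \<subseteq> B}"
      using that by (auto simp: in_keys_iff)
  qed auto
  moreover have "{x :: 'a \<Rightarrow>\<^sub>0 complex. Poly_Mapping.keys x \<subseteq> B0} \<inter> {x. Poly_Mapping.keys x \<subseteq> B1} = {0}"
    using assms by (auto simp flip: keys_eq_empty) blast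
  ultimately show ?thesis
    using vector_space_fscale by (simp add: is_superspace_def based_superalgebra_def)
qed

text \<open>Every axiom is additive in each of its arguments, so nested inductions over finitely
  supported maps reduce it to basis elements. In the Jacobi hypothesis the inner brackets are
  already linear combinations, which is why the outer ones appear as \<open>lin_ext\<close>.\<close>

lemma based_lie_superalgebraI:
  fixes br :: "'b \<Rightarrow> 'b \<Rightarrow> ('b \<Rightarrow>\<^sub>0 complex)" and B0 B1 :: "'b set"
  defines "B \<equiv> \<lambda>p. if p then B1 else B0"
  defines "G \<equiv> based_superalgebra B0 B1 br"
  assumes disjoint: "B0 \<inter> B1 = {}"
    and keys: "\<And>p q b c. b \<in> B p \<Longrightarrow> c \<in> B q \<Longrightarrow> Poly_Mapping.keys (br b c) \<subseteq> B (p \<noteq> q)"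
    and skew: "\<And>p q b c. b \<in> B p \<Longrightarrow> c \<in> B q \<Longrightarrow> br c b = - fscale (sgn_rule p q) (br b c)"
    and jacobi: "\<And>p q b c d. b \<in> B p \<Longrightarrow> c \<in> B q \<Longrightarrow> d \<in> B0 \<union> B1 \<Longrightarrow>
        lin_ext fscale (br b) (br c d) =
        lin_ext fscale (\<lambda>e. br e d) (br b c) + fscale (sgn_rule p q) (lin_ext fscale (br c) (br b d))"
  shows "is_lie_superalgebra G"
proof -
  interpret vector_space fscale by (rule vector_space_fscale)
  note vs = vector_space_fscale
  have bracket_single: "bracket G (Poly_Mapping.single b s) (Poly_Mapping.single c t) = fscale (s * t) (br b c)"
    for b c s t by (simp add: G_def vs)
  have bracket_single_left: "bracket G (Poly_Mapping.single b s) y = fscale s (lin_ext fscale (br b) y)"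
    for b s y by (simp add: G_def vs)
  have bracket_single_right: "bracket G x (Poly_Mapping.single b s) = fscale s (lin_ext fscale (\<lambda>e. br e b) x)"
    for b s x by (simp add: G_def vs lin_ext_scale_fun[OF vs])
  have add: "bracket G (x + x') y = bracket G x y + bracket G x' y"
    "bracket G x (y + y') = bracket G x y + bracket G x y'" for x x' y y'
    by (simp_all only: G_def based_bracket_add)
  have scl: "bracket G (fscale c x) y = fscale c (bracket G x y)"
    "bracket G x (fscale c y) = fscale c (bracket G x y)" for c x y
    by (simp_all only: G_def based_bracket_scale)
  have zero: "bracket G 0 y = 0" "bracket G x 0 = 0" for x y
    using scl(1)[of 0 0 y] scl(2)[of x 0 0] by simp_all
  have lin: "linear_between G G (bracket G x)" "linear_between G G (\<lambda>y. bracket G y x)" for x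
    using add scl by (simp_all add: linear_between_def G_def del: based_superalgebra_sel(3))
  have part: "part G p = {x. Poly_Mapping.keys x \<subseteq> B p}" for p
    by (simp add: G_def B_def)
  have scale: "scale G = fscale" by (simp add: G_def)
  have graded: "Poly_Mapping.keys (bracket G x y) \<subseteq> B (p \<noteq> q)"
    if "Poly_Mapping.keys x \<subseteq> B p" "Poly_Mapping.keys y \<subseteq> B q" for p q x y
    using that
  proof (induction x rule: poly_mapping_keys_induct)
    case (single b s)
    from single(2) show ?case
    proof (induction y rule: poly_mapping_keys_induct)
      case (single c t)
      have "Poly_Mapping.keys (fscale (s * t) (br b c)) \<subseteq> Poly_Mapping.keys (br b c)"
        by (auto simp: in_keys_iff)
      then show ?case using keys[OF \<open>b \<in> B p\<close> single] by (simp add: bracket_single)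
    next
      case (add x y)
      then show ?case using keys_add by (fastforce simp: \<open>\<And>x y y'. bracket G x (y + y') = _\<close>)
    qed (simp add: zero)
  next
    case (add x y)
    then show ?case using keys_add by (fastforce simp: \<open>\<And>x x' y. bracket G (x + x') y = _\<close>)
  qed (simp add: zero)
  have skew': "bracket G y x = - fscale (sgn_rule p q) (bracket G x y)"
    if "Poly_Mapping.keys x \<subseteq> B p" "Poly_Mapping.keys y \<subseteq> B q" for p q x y
    using that
  proof (induction x rule: poly_mapping_keys_induct)
    case (single b s)
    from single(2) show ?case
    proof (induction y rule: poly_mapping_keys_induct)
      case (single c t)
      show ?case
        using skew[OF \<open>b \<in> B p\<close> single] by (simp add: bracket_single mult_ac)
    qed (simp_all add: zero add scale_right_distrib)
  qed (simp_all add: zero add scale_right_distrib)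
  have jacobi': "bracket G x (bracket G y z) =
      bracket G (bracket G x y) z + fscale (sgn_rule p q) (bracket G y (bracket G x z))"
    if "Poly_Mapping.keys x \<subseteq> B p" "Poly_Mapping.keys y \<subseteq> B q"
      "Poly_Mapping.keys z \<subseteq> B0 \<union> B1" for p q x y z
    using that
  proof (induction x rule: poly_mapping_keys_induct)
    case (single b s)
    from single(2,3) show ?case
    proof (induction y rule: poly_mapping_keys_induct)
      case (single c t)
      from single(2) show ?case
      proof (induction z rule: poly_mapping_keys_induct)
        case (single d u)
        \<comment> \<open>The inner brackets are first turned into scaled structure constants. The
          outer ones then have a basis element on one side only and unfold to the
          \<open>lin_ext\<close> terms of \<open>jacobi\<close>, all with the common factor
          \<open>s * t * u\<close>.\<close>
        show ?case
          using jacobi[OF \<open>b \<in> B p\<close> \<open>c \<in> B q\<close> single]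
          by (simp only: bracket_single scl)
            (simp add: bracket_single_left bracket_single_right scale_right_distrib mult_ac)
      qed (simp_all add: zero add scale_right_distrib add_ac)
    qed (simp_all add: zero add scale_right_distrib add_ac)
  qed (simp_all add: zero add scale_right_distrib add_ac)
  have sup: "is_superspace G"
    using is_superspace_based_superalgebra[OF disjoint] by (simp add: G_def)
  have sp: "Poly_Mapping.keys x \<subseteq> B0 \<union> B1" if "x \<in> space G" for x
    using that unfolding G_def by (rule keys_space_based_superalgebra)
  show ?thesis
    unfolding is_lie_superalgebra_def part scale
    by (intro conjI allI ballI CollectI sup lin graded skew' jacobi' sp; simp)
qed

text \<open>Both sides of the bracket identity are bilinear in the two algebra elements, because
  each operator \<open>A b\<close> is linear; the vector \<open>v\<close> stays a parameter.
  Compatibility with the grading survives sums because the parts of \<open>M\<close> are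
  subspaces.\<close>

lemma based_supermoduleI:
  fixes br :: "'b \<Rightarrow> 'b \<Rightarrow> ('b \<Rightarrow>\<^sub>0 complex)" and B0 B1 :: "'b set" and M :: "('b \<Rightarrow>\<^sub>0 complex, 'v::ab_group_add) supermodule"
  defines "B \<equiv> \<lambda>p. if p then B1 else B0"
  defines "G \<equiv> based_superalgebra B0 B1 br"
  assumes lie: "is_lie_superalgebra G" and sup: "is_superspace M"
    and act: "act M = (\<lambda>x v. lin_ext (scale M) (\<lambda>b. A b v) x)"
    and A_add: "\<And>b u v. A b (u + v) = A b u + A b v"
    and A_scale: "\<And>b k v. A b (scale M k v) = scale M k (A b v)"
    and graded: "\<And>p q b v. b \<in> B p \<Longrightarrow> v \<in> part M q \<Longrightarrow> A b v \<in> part M (p \<noteq> q)"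
    and bracket: "\<And>p q b c v. b \<in> B p \<Longrightarrow> c \<in> B q \<Longrightarrow>
        lin_ext (scale M) (\<lambda>d. A d v) (br b c) = A b (A c v) - scale M (sgn_rule p q) (A c (A b v))"
  shows "is_supermodule G M"
proof -
  have vs: "vector_space (scale M)" using sup by (simp add: is_superspace_def)
  interpret vector_space "scale M" by (rule vs)
  have subspace: "subspace (part M p)" for p
    using sup by (cases p) (simp_all add: is_superspace_def part_def)
  have add: "act M (x + x') v = act M x v + act M x' v"
    "act M x (v + v') = act M x v + act M x v'" for x x' v v'
    by (simp_all add: act lin_ext_add lin_ext_add_fun vs A_add)
  have scl: "act M (fscale k x) v = scale M k (act M x v)"
    "act M x (scale M k v) = scale M k (act M x v)" for k x v
    by (simp_all add: act lin_ext_fscale lin_ext_scale_fun[OF vs] vs A_scale)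
  have zero: "act M 0 v = 0" for v
    by (simp add: act)
  have zero': "act M x 0 = 0" for x
    using scl(2)[of x 0 0] by simp
  have single: "act M (Poly_Mapping.single b s) v = scale M s (A b v)" for b s v
    by (simp add: act vs)
  have part: "part G p = {x. Poly_Mapping.keys x \<subseteq> B p}" for p
    by (simp add: G_def B_def)
  have scale: "scale G = fscale" by (simp add: G_def)
  have graded': "act M x v \<in> part M (p \<noteq> q)"
    if "Poly_Mapping.keys x \<subseteq> B p" "v \<in> part M q" for p q x v
    using that
    by (induction x rule: poly_mapping_keys_induct)
      (simp_all only: zero add single subspace_0[OF subspace] subspace_add[OF subspace]
        subspace_scale[OF subspace] graded)
  have bra: "bracket G (x + x') y = bracket G x y + bracket G x' y"
    "bracket G x (y + y') = bracket G x y + bracket G x y'" for x x' y y'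
    by (simp_all only: G_def based_bracket_add)
  have brz: "bracket G 0 y = 0" "bracket G x 0 = 0" for x y
    using bra(1)[of 0 0 y] bra(2)[of x 0 0] by simp_all
  have bracket': "act M (bracket G x y) v =
      act M x (act M y v) - scale M (sgn_rule p q) (act M y (act M x v))"
    if "Poly_Mapping.keys x \<subseteq> B p" "Poly_Mapping.keys y \<subseteq> B q" for p q x y v
    using that
  proof (induction x rule: poly_mapping_keys_induct)
    case (single b s)
    from single(2) show ?case
    proof (induction y rule: poly_mapping_keys_induct)
      case (single c t)
      have "bracket G (Poly_Mapping.single b s) (Poly_Mapping.single c t) = fscale s (fscale t (br b c))"
        by (simp add: G_def vector_space_fscale)
      moreover have "act M (br b c) v = A b (A c v) - scale M (sgn_rule p q) (A c (A b v))"
        using bracket[OF \<open>b \<in> B p\<close> single] by (simp add: act)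
      ultimately show ?case
        by (simp add: scl \<open>\<And>b s v. act M (Poly_Mapping.single b s) v = _\<close> A_scale
            scale_right_diff_distrib mult_ac)
    qed (simp_all add: zero zero' brz bra add scale_right_distrib)
  qed (simp_all add: zero zero' brz bra add scale_right_distrib)
  have lin: "linear_between M M (act M x)" "linear_between G M (\<lambda>x. act M x v)" for x v
    by (simp_all add: linear_between_def scale add scl)
  show ?thesis
    unfolding is_supermodule_def part scale
    by (intro conjI allI ballI lie sup lin graded' bracket'; simp)
qed

section \<open>Transport of supermodule structures along bijections\<close>

lemma superspace_closed:
  fixes V :: "('v::ab_group_add, 'm) superspace_scheme"
  assumes "is_superspace V"
  shows "v \<in> part V p \<Longrightarrow> v \<in> space V"
    and "u \<in> space V \<Longrightarrow> v \<in> space V \<Longrightarrow> u + v \<in> space V"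
    and "v \<in> space V \<Longrightarrow> scale V c v \<in> space V"
proof -
  interpret vector_space "scale V" using assms by (simp add: is_superspace_def)
  have sub: "subspace (even_part V)" "subspace (odd_part V)"
    using assms by (simp_all add: is_superspace_def)
  have "v \<in> space V" if "v \<in> part V p" for v p
  proof (cases p)
    case True
    then show ?thesis
      using that subspace_0[OF sub(1)] by (force simp: space_def part_def)
  next
    case False
    then show ?thesis
      using that subspace_0[OF sub(2)] by (force simp: space_def part_def)
  qed
  then show "v \<in> part V p \<Longrightarrow> v \<in> space V" .
  show "u + v \<in> space V" if uv: "u \<in> space V" "v \<in> space V"
  proof -
    obtain u0 u1 v0 v1 where "u = u0 + u1" "v = v0 + v1"
      "u0 \<in> even_part V" "v0 \<in> even_part V" "u1 \<in> odd_part V" "v1 \<in> odd_part V"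
      using uv by (auto simp: space_def)
    moreover from this have "u + v = (u0 + v0) + (u1 + v1)" by simp
    ultimately show ?thesis
      using subspace_add[OF sub(1)] subspace_add[OF sub(2)] unfolding space_def by blast
  qed
  show "v \<in> space V \<Longrightarrow> scale V c v \<in> space V"
    using subspace_scale[OF sub(1)] subspace_scale[OF sub(2)]
    by (auto simp: space_def scale_right_distrib) blast
qed

text \<open>Since \<open>f\<close> is injective, an identity in \<open>M\<close> may be checked
  after applying \<open>f\<close>, where it becomes an axiom of \<open>N\<close>. Thus
  \<open>M\<close> is not assumed to be a supermodule but inherits this from \<open>N\<close>. The
  intertwining condition is confined to \<open>space G\<close>, as basis symbols outside the algebra
  may act arbitrarily.\<close>

lemma supermodule_iso_transport:
  fixes M :: "('g::ab_group_add, 'v::ab_group_add) supermodule"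
    and N :: "('g, 'w::ab_group_add) supermodule"
  assumes N: "is_supermodule G N" and bij: "bij f"
    and add: "\<And>u v. f (u + v) = f u + f v"
    and scl: "\<And>k v. f (scale M k v) = scale N k (f v)"
    and part: "\<And>p v. v \<in> part M p \<longleftrightarrow> f v \<in> part N p"
    and act: "\<And>x v. x \<in> space G \<Longrightarrow> f (act M x v) = act N x (f v)"
  shows "supermodule_iso G M N f"
proof -
  have inj: "f u = f v \<longleftrightarrow> u = v" for u v
    using bij by (auto simp: bij_def inj_def)
  interpret f: additive f by standard (rule add)
  have supN: "is_superspace N" and lie: "is_lie_superalgebra G"
    using N by (simp_all add: is_supermodule_def)
  have supG: "is_superspace G" using lie by (simp add: is_lie_superalgebra_def)
  have vs: "vector_space (scale N)" using supN by (simp add: is_superspace_def)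
  interpret N: vector_space "scale N" by (rule vs)
  interpret M: vector_space "scale M"
    by unfold_locales
      (simp_all add: inj[symmetric] add scl N.scale_right_distrib N.scale_left_distrib)
  have subN: "N.subspace (part N p)" for p
    using supN by (cases p) (simp_all add: is_superspace_def part_def)
  have "M.subspace (part M p)" for p
    using subN[of p] by (auto simp: M.subspace_def N.subspace_def part add scl f.zero)
  from this[of True] this[of False]
  have subM: "M.subspace (odd_part M)" "M.subspace (even_part M)"
    by (simp_all add: part_def)
  have "even_part M \<inter> odd_part M = {0}"
  proof -
    have "v \<in> even_part M \<inter> odd_part M \<longleftrightarrow> f v \<in> even_part N \<inter> odd_part N" for v
      using part[of v True] part[of v False] by (simp add: part_def)
    also have "\<dots> v \<longleftrightarrow> v = 0" for v
      using supN by (simp add: is_superspace_def f.zero inj[of _ 0, unfolded f.zero])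
    finally show ?thesis by blast
  qed
  then have supM: "is_superspace M"
    using subM M.vector_space_axioms by (simp add: is_superspace_def)
  have ev: "v \<in> even_part M \<longleftrightarrow> f v \<in> even_part N" and od: "v \<in> odd_part M \<longleftrightarrow> f v \<in> odd_part N" for v
    using part[of v False] part[of v True] by (simp_all add: part_def)
  have space: "v \<in> space M \<longleftrightarrow> f v \<in> space N" for v
  proof
    assume "v \<in> space M"
    then obtain u w where "v = u + w" "u \<in> even_part M" "w \<in> odd_part M"
      unfolding space_def by blast
    then show "f v \<in> space N"
      unfolding space_def using ev od add by blast
  next
    assume "f v \<in> space N"
    then obtain u' w' where uw': "f v = u' + w'" "u' \<in> even_part N" "w' \<in> odd_part N"
      unfolding space_def by blast
    \<comment> \<open>Preimages exist by surjectivity; they have the right parity because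
      \<open>part\<close> is an equivalence.\<close>
    obtain u w where uw: "u' = f u" "w' = f w"
      using bij by (meson bij_pointE)
    have "v = u + w" using uw' uw by (simp add: add[symmetric] inj)
    then show "v \<in> space M"
      using uw' uw ev od unfolding space_def by blast
  qed
  have lin1: "linear_between M M (act M x)" if "x \<in> space G" for x
    using N that by (auto simp: is_supermodule_def linear_between_def inj[symmetric] act add scl space)
  have lin2: "linear_between G M (\<lambda>x. act M x v)" if "v \<in> space M" for v
  proof -
    have "linear_between G N (\<lambda>x. act N x (f v))"
      using N that space by (simp add: is_supermodule_def)
    moreover have "x + y \<in> space G" "scale G c x \<in> space G" if "x \<in> space G" "y \<in> space G" for x y c
      using that superspace_closed[OF supG] by blast+
    ultimately show ?thesis
      by (auto simp: linear_between_def inj[symmetric] act add scl)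
  qed
  have sp: "x \<in> space G" if "x \<in> part G p" for x p
    using that superspace_closed(1)[OF supG] by blast
  have graded: "act M x v \<in> part M (p \<noteq> q)" if "x \<in> part G p" "v \<in> part M q" for x v p q
    using N that sp[OF that(1)] unfolding part by (simp add: is_supermodule_def act)
  have bracket: "act M (bracket G x y) v =
      act M x (act M y v) - scale M (sgn_rule p q) (act M y (act M x v))"
    if "x \<in> part G p" "y \<in> part G q" "v \<in> space M" for x y v p q
  proof -
    \<comment> \<open>\<open>act\<close> applies to elements of \<open>space G\<close> only, so the
      bracket has to be located there first.\<close>
    have "bracket G x y \<in> part G (p \<noteq> q)"
      using lie that unfolding is_lie_superalgebra_def by blast
    then have "f (act M (bracket G x y) v) = act N (bracket G x y) (f v)"
      using act sp by blast
    also have "\<dots> = act N x (act N y (f v)) - scale N (sgn_rule p q) (act N y (act N x (f v)))"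
      using N that space unfolding is_supermodule_def by blast
    also have "\<dots> = f (act M x (act M y v) - scale M (sgn_rule p q) (act M y (act M x v)))"
      using sp that by (simp add: f.diff scl act)
    finally show ?thesis by (simp add: inj)
  qed
  have "is_supermodule G M"
    unfolding is_supermodule_def
    by (intro conjI allI ballI lie supM lin1 lin2 graded bracket; simp)
  moreover have "bij_betw f (space M) (space N)"
  proof (rule bij_betw_imageI)
    show "f ` space M = space N"
    proof (intro equalityI subsetI)
      fix w assume "w \<in> space N"
      moreover obtain v where "w = f v" using bij by (meson bij_pointE)
      ultimately show "w \<in> f ` space M" using space by blast
    qed (use space in blast)
  qed (simp add: inj_on_def inj)
  ultimately show ?thesis
    using N unfolding supermodule_iso_def by (auto simp: linear_between_def add scl part act)
qed

section \<open>The centerless N = 1 algebras satisfy the Lie superalgebra axioms\<close>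

text \<open>In both cases \<open>2 * \<epsilon>\<close> is an integer, namely 0 or 1. So the sum of
  two admissible indices is an integer, and the floors in the bracket and in the exponents are
  exact.\<close>

lemma half_integral_floor:
  fixes r s \<epsilon> :: rat
  assumes "\<epsilon> = 0 \<or> \<epsilon> = 1/2" and "r \<in> {\<epsilon> + of_int k | k. True}" and "s \<in> {\<epsilon> + of_int k | k. True}"
  shows "of_int \<lfloor>r + s\<rfloor> = r + s" and "of_int \<lfloor>2 * r\<rfloor> = 2 * r"
proof -
  from assms obtain k l where kl: "r = \<epsilon> + of_int k" "s = \<epsilon> + of_int l" by blast
  obtain e where e: "2 * \<epsilon> = of_int e"
    using assms(1) by (metis mult_zero_right nonzero_mult_div_cancel_left of_int_0 of_int_1 times_divide_eq_right zero_neq_numeral)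
  have "r + s = of_int (e + k + l)" "2 * r = of_int (e + 2 * k)"
    using kl e by (simp_all add: algebra_simps)
  then show "of_int \<lfloor>r + s\<rfloor> = r + s" "of_int \<lfloor>2 * r\<rfloor> = 2 * r"
    by (metis floor_of_int)+
qed

lemma of_int_eq_of_rat: "of_int n = x \<Longrightarrow> (of_int n :: complex) = of_rat x"
  by (metis of_rat_of_int_eq)

lemma is_lie_superalgebra_n1:
  assumes "\<epsilon> = 0 \<or> \<epsilon> = 1/2"
  shows "is_lie_superalgebra (n1_algebra \<epsilon>)"
proof -
  define R :: "rat set" where "R = {\<epsilon> + of_int k | k. True}"
  note vs = vector_space_fscale
  \<comment> \<open>Two versions: the rational one for the indices of \<open>GG\<close>, the complex
    one for the coefficients.\<close>
  have fl: "of_int \<lfloor>r + s\<rfloor> = r + s" "(of_int \<lfloor>r + s\<rfloor> :: complex) = of_rat r + of_rat s"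
    if "r \<in> R" "s \<in> R" for r s
    using half_integral_floor(1)[OF assms that[unfolded R_def]] of_int_eq_of_rat
    by (auto simp: of_rat_add[symmetric])
  have shift: "of_int m + r \<in> R" if "r \<in> R" for m r
  proof -
    from that obtain k where "r = \<epsilon> + of_int k" by (auto simp: R_def)
    then have "of_int m + r = \<epsilon> + of_int (m + k)" by simp
    then show ?thesis unfolding R_def by blast
  qed
  have single_eqI: "x = y \<Longrightarrow> c = d \<Longrightarrow> Poly_Mapping.single x c = Poly_Mapping.single y d"
    for x y :: n1_basis and c d :: complex by simp
  show ?thesis
    unfolding n1_algebra_def R_def[symmetric]
  proof (rule based_lie_superalgebraI)
    show "range LL \<inter> GG ` R = {}" by auto
  next
    fix p q b c
    assume "b \<in> (if p then GG ` R else range LL)" "c \<in> (if q then GG ` R else range LL)"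
    then show "Poly_Mapping.keys (n1_bracket b c) \<subseteq> (if p \<noteq> q then GG ` R else range LL)"
      by (cases p; cases q) (auto simp: shift split: if_splits)
  next
    fix p q b c
    assume "b \<in> (if p then GG ` R else range LL)" "c \<in> (if q then GG ` R else range LL)"
    then show "n1_bracket c b = - fscale (sgn_rule p q) (n1_bracket b c)"
      by (cases p; cases q) (auto simp: sgn_rule_def single_uminus[symmetric] add_ac)
  next
    fix p q b c d
    assume "b \<in> (if p then GG ` R else range LL)" "c \<in> (if q then GG ` R else range LL)"
      "d \<in> range LL \<union> GG ` R"
    \<comment> \<open>For each choice of parities both sides are multiples of a single basis
      element, so it suffices to compare its index and its coefficient.\<close>
    then show "lin_ext fscale (n1_bracket b) (n1_bracket c d) =
        lin_ext fscale (\<lambda>e. n1_bracket e d) (n1_bracket b c) +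
        fscale (sgn_rule p q) (lin_ext fscale (n1_bracket c) (n1_bracket b d))"
      by (cases p; cases q;
          auto simp: sgn_rule_def vs fl shift single_add[symmetric] of_rat_add
            int_add_floor floor_add_int add_ac intro!: single_eqI;
          simp add: field_simps fl)
  qed
qed

section \<open>The common model \<open>N1_module\<close> for both N = 1 algebras\<close>

text \<open>Over an infinite field polynomials are determined by their values. Operator identities
  thereby become identities between complex numbers, with shifts acting as translations of the
  argument.\<close>

lemma poly_ext: "(\<And>z. poly p z = poly q z) \<Longrightarrow> p = q"
  for p q :: "complex poly"
  using poly_eq_poly_eq_iff by blast

lemma shift_smult [simp]: "shift c (smult k f) = smult k (shift c f)"
  by (rule poly_ext) simp

text \<open>A module on pairs that depends on a square root \<open>\<mu>\<close> of \<open>\<lambda>\<close>: the factor of \<open>GG r\<close> is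
  \<open>\<mu>\<^sup>2\<^sup>r\<close>, which makes sense for integral and half-integral \<open>r\<close> alike.\<close>

fun N1_basis_act ::
    "complex \<Rightarrow> complex \<Rightarrow> n1_basis \<Rightarrow> complex poly \<times> complex poly \<Rightarrow> complex poly \<times> complex poly" where
  "N1_basis_act \<mu> c (LL m) (f, g) =
     (smult (\<mu> powi (2 * m)) ([:of_int m * c, 1:] * shift (of_int m) f),
      smult (\<mu> powi (2 * m)) ([:of_int m * (c + 1/2), 1:] * shift (of_int m) g))"
| "N1_basis_act \<mu> c (GG r) (f, g) =
     (smult (\<mu> powi \<lfloor>2 * r\<rfloor>) ([:2 * of_rat r * c, 1:] * shift (of_rat r) g),
      smult (\<mu> powi \<lfloor>2 * r\<rfloor>) (shift (of_rat r) f))"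

definition N1_module ::
    "complex \<Rightarrow> complex \<Rightarrow> (n1_basis \<Rightarrow>\<^sub>0 complex, complex poly \<times> complex poly) supermodule" where
  "N1_module \<mu> c =
     \<lparr>scale = pair_scale,
      even_part = {(f, 0) | f. True},
      odd_part = {(0, g) | g. True},
      act = (\<lambda>x v. lin_ext pair_scale (\<lambda>b. N1_basis_act \<mu> c b v) x)\<rparr>"

lemma vector_space_pair_scale: "vector_space pair_scale"
  by unfold_locales (auto simp: pair_scale_def prod_eq_iff smult_add_right smult_add_left)

lemma pair_scale_simp [simp]: "pair_scale k (f, g) = (smult k f, smult k g)"
  by (simp add: pair_scale_def)

text \<open>The decisive relation is that of two odd generators. On the even part the factors
  \<open>x + 2 * r * c\<close> and \<open>x + 2 * s * c\<close> add up to twice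
  \<open>x + (r + s) * c\<close>. On the odd part the factor is shifted before the sum is taken,
  which produces the extra 1/2 in \<open>c + 1/2\<close>. The powers of \<mu> match because
  \<open>\<lfloor>2 * r\<rfloor>\<close> is additive on admissible indices.\<close>

lemma is_supermodule_N1_module:
  assumes "\<epsilon> = 0 \<or> \<epsilon> = 1/2" and "\<mu> \<noteq> 0"
  shows "is_supermodule (n1_algebra \<epsilon>) (N1_module \<mu> c)"
proof -
  define R :: "rat set" where "R = {\<epsilon> + of_int k | k. True}"
  \<comment> \<open>Opaque, so that arithmetic normalisation leaves the exponents alone.\<close>
  define d where "d r = \<lfloor>2 * r\<rfloor>" for r :: rat
  note vs = vector_space_pair_scale
  interpret vector_space pair_scale by (rule vs)
  have fl: "of_int \<lfloor>r + s\<rfloor> = r + s" "(of_int \<lfloor>r + s\<rfloor> :: complex) = of_rat r + of_rat s"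
      "2 * \<lfloor>r + s\<rfloor> = \<lfloor>2 * r\<rfloor> + \<lfloor>2 * s\<rfloor>"
    if "r \<in> R" "s \<in> R" for r s
  proof -
    show 1: "of_int \<lfloor>r + s\<rfloor> = r + s"
      using half_integral_floor(1)[OF assms(1) that[unfolded R_def]] .
    then show "(of_int \<lfloor>r + s\<rfloor> :: complex) = of_rat r + of_rat s"
      using of_int_eq_of_rat[OF 1] by (simp add: of_rat_add)
    \<comment> \<open>The integers are compared inside the rationals, where all three floors are
      exact.\<close>
    have "of_int (2 * \<lfloor>r + s\<rfloor>) = (of_int (\<lfloor>2 * r\<rfloor> + \<lfloor>2 * s\<rfloor>) :: rat)"
      by (simp only: of_int_mult of_int_add of_int_numeral distrib_left 1
          half_integral_floor(2)[OF assms(1) that[unfolded R_def]]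
          half_integral_floor(2)[OF assms(1) that(2,1)[unfolded R_def]])
    then show "2 * \<lfloor>r + s\<rfloor> = \<lfloor>2 * r\<rfloor> + \<lfloor>2 * s\<rfloor>" by (simp only: of_int_eq_iff)
  qed
  have fl2: "\<lfloor>2 * of_int m + 2 * r\<rfloor> = 2 * m + \<lfloor>2 * r\<rfloor>" for m and r :: rat
    using int_add_floor[of "2 * m" "2 * r"] by simp
  have d_add: "d (of_int m + r) = 2 * m + d r" for m r
    using fl2 by (simp add: d_def)
  have d_floor: "2 * \<lfloor>r + s\<rfloor> = d r + d s" if "r \<in> R" "s \<in> R" for r s
    using fl(3)[OF that] by (simp add: d_def)
  have act_GG: "N1_basis_act \<mu> c (GG r) (f, g) =
      (smult (\<mu> powi d r) ([:2 * of_rat r * c, 1:] * shift (of_rat r) g),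
       smult (\<mu> powi d r) (shift (of_rat r) f))" for r f g
    by (simp add: d_def)
  let ?M = "N1_module \<mu> c"
  have sel: "scale ?M = pair_scale"
    "part ?M p = (if p then {(0, g) | g. True} else {(f, 0) | f. True})" for p
    by (simp_all add: N1_module_def part_def)
  show ?thesis
    unfolding n1_algebra_def R_def[symmetric]
  proof (rule based_supermoduleI[where A = "N1_basis_act \<mu> c"])
    show "is_lie_superalgebra (based_superalgebra (range LL) (GG ` R) n1_bracket)"
      using is_lie_superalgebra_n1[OF assms(1)] by (simp add: n1_algebra_def R_def)
    show "is_superspace ?M"
      using vs by (auto simp: is_superspace_def N1_module_def subspace_def zero_prod_def)
    show "act ?M = (\<lambda>x v. lin_ext (scale ?M) (\<lambda>b. N1_basis_act \<mu> c b v) x)"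
      by (simp add: N1_module_def)
  next
    fix b and u v :: "complex poly \<times> complex poly"
    show "N1_basis_act \<mu> c b (u + v) = N1_basis_act \<mu> c b u + N1_basis_act \<mu> c b v"
      by (cases b; cases u; cases v)
        (auto intro!: poly_ext simp: algebra_simps simp del: mult_pCons_left)
  next
    fix b k and v :: "complex poly \<times> complex poly"
    show "N1_basis_act \<mu> c b (scale ?M k v) = scale ?M k (N1_basis_act \<mu> c b v)"
      by (cases b; cases v) (auto intro!: poly_ext simp: sel algebra_simps simp del: mult_pCons_left)
  next
    fix p q b v
    assume "b \<in> (if p then GG ` R else range LL)" "v \<in> part ?M q"
    then show "N1_basis_act \<mu> c b v \<in> part ?M (p \<noteq> q)"
      by (cases p; cases q) (auto simp: sel shift_def)
  next
    fix p q b b' v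
    assume "b \<in> (if p then GG ` R else range LL)" "b' \<in> (if q then GG ` R else range LL)"
    \<comment> \<open>Both sides are evaluated at a point; \<open>d_add\<close> and
      \<open>d_floor\<close> align the powers of \<mu>, and an algebraic identity remains.\<close>
    then show "lin_ext (scale ?M) (\<lambda>e. N1_basis_act \<mu> c e v) (n1_bracket b b') =
        N1_basis_act \<mu> c b (N1_basis_act \<mu> c b' v) -
        scale ?M (sgn_rule p q) (N1_basis_act \<mu> c b' (N1_basis_act \<mu> c b v))"
      by (cases v; cases p; cases q;
          auto simp: sel sgn_rule_def vs fl(1,2) d_floor d_add act_GG of_rat_add power_int_add assms(2)
            simp del: mult_pCons_left N1_basis_act.simps(2) intro!: poly_ext;
          simp add: field_simps fl(1,2) power_int_add assms(2))
  qed
qed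

section \<open>The two Omega modules are copies of the common model\<close>

text \<open>Both actions are linear extensions, so intertwining is a matter of basis elements. Odd
  indices are restricted to \<open>\<epsilon> + of_int k\<close>, since no others occur in elements
  of the algebra.\<close>

lemma n1_supermodule_isoI:
  fixes M :: "(n1_basis \<Rightarrow>\<^sub>0 complex, 'v::ab_group_add) supermodule"
    and N :: "(n1_basis \<Rightarrow>\<^sub>0 complex, 'w::ab_group_add) supermodule"
  assumes N: "is_supermodule (n1_algebra \<epsilon>) N" and "bij f"
    and add: "\<And>u v. f (u + v) = f u + f v"
    and scl: "\<And>k v. f (scale M k v) = scale N k (f v)"
    and "\<And>p v. v \<in> part M p \<longleftrightarrow> f v \<in> part N p"
    and actM: "\<And>x v. act M x v = lin_ext (scale M) (\<lambda>b. A b v) x"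
    and actN: "\<And>x v. act N x v = lin_ext (scale N) (\<lambda>b. B b v) x"
    and LL: "\<And>m v. f (A (LL m) v) = B (LL m) (f v)"
    and GG: "\<And>k v. f (A (GG (\<epsilon> + of_int k)) v) = B (GG (\<epsilon> + of_int k)) (f v)"
  shows "supermodule_iso (n1_algebra \<epsilon>) M N f"
proof (rule supermodule_iso_transport)
  fix x v
  assume "x \<in> space (n1_algebra \<epsilon>)"
  then have "Poly_Mapping.keys x \<subseteq> range LL \<union> GG ` {\<epsilon> + of_int k | k. True}"
    unfolding n1_algebra_def by (rule keys_space_based_superalgebra)
  then have "lin_ext (scale N) (\<lambda>b. f (A b v)) x = lin_ext (scale N) (\<lambda>b. B b (f v)) x"
    by (rule lin_ext_cong) (auto simp: LL GG)
  then show "f (act M x v) = act N x (f v)"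
    by (simp add: actM actN lin_ext_map[where f = f and sc' = "scale N", OF add scl])
qed (fact assms)+

lemma even_coeffs_add: "even_coeffs (p + q) = even_coeffs p + even_coeffs q"
  and odd_coeffs_add: "odd_coeffs (p + q) = odd_coeffs p + odd_coeffs q"
  and even_coeffs_smult: "even_coeffs (smult k p) = smult k (even_coeffs p)"
  and odd_coeffs_smult: "odd_coeffs (smult k p) = smult k (odd_coeffs p)"
  by (rule poly_eqI; simp add: coeff_even_coeffs coeff_odd_coeffs)+

lemma at_sq_0 [simp]: "at_sq 0 = 0"
  by (simp add: at_sq_def)

lemma at_sq_add: "at_sq (f + g) = at_sq f + at_sq g"
  by (simp add: at_sq_def pcompose_add)

lemma at_sq_smult: "at_sq (smult k f) = smult k (at_sq f)"
  by (simp add: at_sq_def pcompose_smult)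

text \<open>By uniqueness of the parity decomposition, membership in one part is the vanishing of
  the other component, a condition that transports directly to pairs.\<close>

lemma in_range_at_sq_iff: "p \<in> range at_sq \<longleftrightarrow> odd_coeffs p = 0"
  and in_range_x_at_sq_iff: "p \<in> {[:0, 1:] * at_sq f | f. True} \<longleftrightarrow> even_coeffs p = 0"
proof -
  have "odd_coeffs (at_sq f) = 0" "even_coeffs ([:0, 1:] * at_sq f) = 0" for f
    using even_odd_coeffs(2)[of f 0] even_odd_coeffs(1)[of 0 f] by simp_all
  then show "p \<in> range at_sq \<longleftrightarrow> odd_coeffs p = 0"
    "p \<in> {[:0, 1:] * at_sq f | f. True} \<longleftrightarrow> even_coeffs p = 0"
    using parity_decomposition[of p] by (auto simp del: mult_pCons_left)
qed

lemma bij_parity_decomposition: "bij (\<lambda>p. (even_coeffs p, odd_coeffs p))"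
  by (rule o_bij[where g = "\<lambda>(f, g). at_sq f + [:0, 1:] * at_sq g"])
    (auto simp: fun_eq_iff parity_decomposition[symmetric] simp del: mult_pCons_left)

text \<open>For integral \<open>r\<close> the factor \<open>(\<mu>\<^sup>2) powi r\<close> is
  \<open>\<mu> powi (2 * r)\<close>, so separating even and odd coefficients already intertwines the
  actions.\<close>

lemma Omega_R_iso_N1_module:
  assumes "\<mu> \<noteq> 0"
  shows "supermodule_iso ramond_n1 (Omega_R (\<mu>\<^sup>2) c) (N1_module \<mu> c)
    (\<lambda>p. (even_coeffs p, odd_coeffs p))"
  unfolding ramond_n1_def
proof (rule n1_supermodule_isoI[where A = "Omega_R_basis_act (\<mu>\<^sup>2) c" and B = "N1_basis_act \<mu> c"])
  show "is_supermodule (n1_algebra 0) (N1_module \<mu> c)"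
    using assms by (simp add: is_supermodule_N1_module)
  show "bij (\<lambda>p. (even_coeffs p, odd_coeffs p))"
    by (rule bij_parity_decomposition)
  show "(v \<in> part (Omega_R (\<mu>\<^sup>2) c) p) = ((even_coeffs v, odd_coeffs v) \<in> part (N1_module \<mu> c) p)"
    for v p
    using in_range_at_sq_iff[of v] in_range_x_at_sq_iff[of v]
    by (auto simp: Omega_R_def N1_module_def part_def)
  have pw: "\<mu>\<^sup>2 powi m = \<mu> powi (2 * m)" for m
    by (simp add: power_int_mult)
  show "(even_coeffs (Omega_R_basis_act (\<mu>\<^sup>2) c (LL m) v), odd_coeffs (Omega_R_basis_act (\<mu>\<^sup>2) c (LL m) v)) =
      N1_basis_act \<mu> c (LL m) (even_coeffs v, odd_coeffs v)" for m v
    by (simp add: pw del: mult_pCons_left)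
  have fl: "\<lfloor>2 * of_int k :: rat\<rfloor> = 2 * k" for k
    by (metis floor_of_int of_int_mult of_int_numeral)
  show "(even_coeffs (Omega_R_basis_act (\<mu>\<^sup>2) c (GG (0 + of_int k)) v),
        odd_coeffs (Omega_R_basis_act (\<mu>\<^sup>2) c (GG (0 + of_int k)) v)) =
      N1_basis_act \<mu> c (GG (0 + of_int k)) (even_coeffs v, odd_coeffs v)" for k v
    by (simp add: pw fl del: mult_pCons_left)
qed (simp_all add: Omega_R_def N1_module_def even_coeffs_add odd_coeffs_add even_coeffs_smult
    odd_coeffs_smult)

lemma bij_scale_odd:
  assumes "k \<noteq> 0"
  shows "bij (\<lambda>v :: complex poly \<times> complex poly. (fst v, smult k (snd v)))"
  by (rule o_bij[where g = "\<lambda>v. (fst v, smult (1 / k) (snd v))"]) (use assms in \<open>auto simp: fun_eq_iff\<close>)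

lemma floor_half: "\<lfloor>2 * (1/2 + of_int k :: rat)\<rfloor> = 2 * k + 1"
  "\<lfloor>1/2 + of_int k + 1/2 :: rat\<rfloor> = k + 1" "\<lfloor>1/2 + of_int k - 1/2 :: rat\<rfloor> = k"
proof -
  have "2 * (1/2 + of_int k :: rat) = of_int (2 * k + 1)" "1/2 + of_int k + 1/2 = (of_int (k + 1) :: rat)"
    by simp_all
  then show "\<lfloor>2 * (1/2 + of_int k :: rat)\<rfloor> = 2 * k + 1" "\<lfloor>1/2 + of_int k + 1/2 :: rat\<rfloor> = k + 1"
    by (simp_all only: floor_of_int)
qed simp

text \<open>With \<lambda> the square of \<mu>, the odd generators carry the exponents
  \<open>2 * r - 1\<close> and \<open>2 * r + 1\<close> of \<mu>, depending on the part they act on.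
  Scaling the odd part by \<mu> balances both to \<open>2 * r\<close>.\<close>

lemma Omega_NS_iso_N1_module:
  assumes "\<mu> \<noteq> 0"
  shows "supermodule_iso neveu_schwarz_n1 (Omega_NS (\<mu>\<^sup>2) c) (N1_module \<mu> c)
    (\<lambda>v. (fst v, smult \<mu> (snd v)))"
  unfolding neveu_schwarz_n1_def
proof (rule n1_supermodule_isoI[where A = "Omega_NS_basis_act (\<mu>\<^sup>2) c" and B = "N1_basis_act \<mu> c"])
  show "is_supermodule (n1_algebra (1/2)) (N1_module \<mu> c)"
    using assms by (simp add: is_supermodule_N1_module)
  show "bij (\<lambda>v :: complex poly \<times> complex poly. (fst v, smult \<mu> (snd v)))"
    using assms by (rule bij_scale_odd)
  show "(v \<in> part (Omega_NS (\<mu>\<^sup>2) c) p) = ((fst v, smult \<mu> (snd v)) \<in> part (N1_module \<mu> c) p)"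
    for v p
    using assms by (cases v) (auto simp: Omega_NS_def N1_module_def part_def)
  have pw: "\<mu>\<^sup>2 powi m = \<mu> powi (2 * m)" for m
    by (simp add: power_int_mult)
  show "(fst (Omega_NS_basis_act (\<mu>\<^sup>2) c (LL m) v), smult \<mu> (snd (Omega_NS_basis_act (\<mu>\<^sup>2) c (LL m) v))) =
      N1_basis_act \<mu> c (LL m) (fst v, smult \<mu> (snd v))" for m v
    by (cases v) (simp add: pw mult_ac smult_add_right)
  show "(fst (Omega_NS_basis_act (\<mu>\<^sup>2) c (GG (1/2 + of_int k)) v),
        smult \<mu> (snd (Omega_NS_basis_act (\<mu>\<^sup>2) c (GG (1/2 + of_int k)) v))) =
      N1_basis_act \<mu> c (GG (1/2 + of_int k)) (fst v, smult \<mu> (snd v))" for k v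
  proof (cases v)
    case (Pair f g)
    show ?thesis
      unfolding Pair Omega_NS_basis_act.simps N1_basis_act.simps fst_conv snd_conv pw floor_half prod.inject
      by (intro conjI poly_ext; simp add: assms power_int_add power2_eq_square algebra_simps)
  qed
qed (simp_all add: Omega_NS_def N1_module_def pair_scale_def smult_add_right mult_ac)

section \<open>Restriction of S along the two homomorphisms\<close>

lemma S_basis_act_C [simp]: "S_basis_act lam \<alpha> a C v = 0"
  by (cases v) (simp add: zero_prod_def)

text \<open>The chosen representative differs from \<open>y\<close> by a multiple of
  \<open>C\<close>, which acts as zero; so any representative computes the action of its
  class.\<close>

lemma act_mod_C_abs:
  "act (mod_C (S_module lam \<alpha> a)) (abs_n2_mod_C y) v =
     lin_ext pair_scale (\<lambda>b. S_basis_act lam \<alpha> a b v) y"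
proof -
  interpret vector_space pair_scale by (rule vector_space_pair_scale)
  have "abs_n2_mod_C (rep_n2_mod_C (abs_n2_mod_C y)) = abs_n2_mod_C y"
    by (rule Quotient3_abs_rep[OF Quotient3_n2_mod_C])
  then obtain c where "rep_n2_mod_C (abs_n2_mod_C y) = y + Poly_Mapping.single C c"
    by (metis n2_mod_C.abs_eq_iff diff_add_cancel add.commute)
  then show ?thesis
    by (simp add: mod_C_def pullback_def S_module_def lin_ext_add vector_space_pair_scale)
qed

definition S_n1_basis_act ::
    "complex \<Rightarrow> complex \<Rightarrow> complex \<Rightarrow> n1_basis \<Rightarrow> complex poly \<times> complex poly \<Rightarrow> complex poly \<times> complex poly" where
  "S_n1_basis_act lam \<alpha> a b v = (case b of
      LL m \<Rightarrow> S_basis_act lam \<alpha> a (L m) v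
    | GG r \<Rightarrow> pair_scale (1 / of_real (sqrt 2))
        (S_basis_act lam \<alpha> a (Gp \<lfloor>r\<rfloor>) v + S_basis_act lam \<alpha> a (Gm \<lfloor>r\<rfloor>) v))"

text \<open>The action is linear in the class and hence passes through the linear extension that
  defines \<open>Upsilon2\<close>.\<close>

lemma act_Upsilon2:
  "act (mod_C (S_module lam \<alpha> a)) (Upsilon2 x) v =
     lin_ext pair_scale (\<lambda>b. S_n1_basis_act lam \<alpha> a b v) x"
proof -
  note vs = vector_space_pair_scale
  let ?\<phi> = "\<lambda>X. act (mod_C (S_module lam \<alpha> a)) X v"
  have add: "?\<phi> (X + Y) = ?\<phi> X + ?\<phi> Y" for X Y
    by (induction X rule: n2_mod_C.abs_induct; induction Y rule: n2_mod_C.abs_induct)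
      (simp add: plus_n2_mod_C.abs_eq act_mod_C_abs lin_ext_add vs)
  have scl: "?\<phi> (n2_mod_C_scale c X) = pair_scale c (?\<phi> X)" for c X
    by (induction X rule: n2_mod_C.abs_induct) (simp add: n2_mod_C_scale.abs_eq act_mod_C_abs lin_ext_fscale vs)
  have one: "pair_scale 1 w = w" for w by (simp add: pair_scale_def)
  show ?thesis
    unfolding Upsilon2_def lin_ext_map[where f = ?\<phi> and sc = n2_mod_C_scale and sc' = pair_scale, OF add scl]
    by (rule arg_cong[where f = "\<lambda>h. lin_ext pair_scale h x"])
      (auto simp: fun_eq_iff S_n1_basis_act_def scl act_mod_C_abs lin_ext_add vs one
        split: n1_basis.split)
qed

lemma act_Upsilon2_Upsilon1:
  "act (mod_C (S_module lam \<alpha> a)) (Upsilon2 (Upsilon1 x)) v =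
     lin_ext pair_scale (\<lambda>b. case b of
       LL m \<Rightarrow> pair_scale (1/2) (S_n1_basis_act lam \<alpha> a (LL (2 * m)) v)
     | GG r \<Rightarrow> pair_scale (1 / of_real (sqrt 2)) (S_n1_basis_act lam \<alpha> a (GG (2 * r)) v)) x"
proof -
  note vs = vector_space_pair_scale
  let ?\<phi> = "\<lambda>x. lin_ext pair_scale (\<lambda>b. S_n1_basis_act lam \<alpha> a b v) x"
  have "?\<phi> (Upsilon1 x) = lin_ext pair_scale (\<lambda>b. ?\<phi> (case b of
      LL m \<Rightarrow> Poly_Mapping.single (LL (2 * m)) (1/2)
    | GG r \<Rightarrow> Poly_Mapping.single (GG (2 * r)) (1 / of_real (sqrt 2)))) x"
    unfolding Upsilon1_def by (rule lin_ext_map) (simp_all add: lin_ext_add lin_ext_fscale vs)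
  then show ?thesis
    unfolding act_Upsilon2 by (simp add: vs n1_basis.case_distrib cong: n1_basis.case_cong)
qed

section \<open>The isomorphisms from S to the Omega modules\<close>

lemma bij_S_to_Omega_R:
  assumes "k \<noteq> 0"
  shows "bij (\<lambda>v. at_sq (fst v) + [:0, 1:] * at_sq (smult k (snd v)))"
  by (rule o_bij[where g = "\<lambda>p. (even_coeffs p, smult (1 / k) (odd_coeffs p))"])
    (use assms in \<open>auto simp: fun_eq_iff parity_decomposition[symmetric] simp del: mult_pCons_left\<close>)

lemma sqrt_2_squared: "of_real (sqrt 2) * of_real (sqrt 2) = (2 :: complex)"
  by (simp flip: of_real_mult)

text \<open>Moves the root into the numerator, where \<open>sqrt_2_squared\<close> can eliminate
  it.\<close>

lemma inverse_sqrt_2: "1 / of_real (sqrt 2) = (of_real (sqrt 2) / 2 :: complex)"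
  using sqrt_2_squared by (simp add: field_simps)

text \<open>With \<open>c = - a / 2\<close> the even operators agree verbatim. For the odd scalar
  \<open>k\<close>, the map from even to odd demands \<open>k * \<alpha> / sqrt 2 = 1\<close>, and
  the map back demands \<open>2 / (sqrt 2 * \<alpha>) = k\<close>; both are solved by
  \<open>sqrt 2 / \<alpha>\<close>.\<close>

lemma S_iso_Omega_R:
  assumes "lam \<noteq> 0" and "\<alpha> \<noteq> 0"
  shows "supermodule_iso ramond_n1 (as_ramond_module (S_module lam \<alpha> a)) (Omega_R lam (- (1/2) * a))
    (\<lambda>v. at_sq (fst v) + [:0, 1:] * at_sq (smult (of_real (sqrt 2) / \<alpha>) (snd v)))"
proof -
  let ?M = "as_ramond_module (S_module lam \<alpha> a)" and ?N = "Omega_R lam (- (1/2) * a)"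
  define k where "k = of_real (sqrt 2) / \<alpha>"
  let ?f = "\<lambda>v. at_sq (fst v) + [:0, 1:] * at_sq (smult k (snd v))"
  have "k \<noteq> 0" using assms by (simp add: k_def)
  have "supermodule_iso (n1_algebra 0) ?M ?N ?f"
  proof (rule n1_supermodule_isoI[where A = "S_n1_basis_act lam \<alpha> a" and B = "Omega_R_basis_act lam (- (1/2) * a)"])
    show "is_supermodule (n1_algebra 0) ?N"
      \<comment> \<open>The common model needs a square root of \<lambda>; \<open>csqrt\<close>
        supplies a nonzero one.\<close>
      using Omega_R_iso_N1_module[of "csqrt lam" "- (1/2) * a"] assms
      by (simp add: supermodule_iso_def ramond_n1_def)
    show "bij ?f" using \<open>k \<noteq> 0\<close> by (rule bij_S_to_Omega_R)
    show "act ?M x v = lin_ext (scale ?M) (\<lambda>b. S_n1_basis_act lam \<alpha> a b v) x" for x v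
      using act_Upsilon2 by (simp add: as_ramond_module_def pullback_def mod_C_def S_module_def)
    show "(v \<in> part ?M p) = (?f v \<in> part ?N p)" for p v
      using \<open>k \<noteq> 0\<close> in_range_at_sq_iff[of "?f v"] in_range_x_at_sq_iff[of "?f v"]
      by (cases v) (auto simp: as_ramond_module_def pullback_def mod_C_def S_module_def Omega_R_def part_def
          simp del: mult_pCons_left)
    note unfolds = S_n1_basis_act_def n1_basis.case S_basis_act.simps Omega_R_basis_act.simps even_odd_coeffs
      fst_conv snd_conv pair_scale_simp
    show "?f (S_n1_basis_act lam \<alpha> a (LL m) v) = Omega_R_basis_act lam (- (1/2) * a) (LL m) (?f v)" for m v
    proof (cases v)
      case (Pair g h)
      \<comment> \<open>Both sides have the form \<open>at_sq _ + [:0, 1:] * at_sq _\<close>, so the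
        arguments of \<open>at_sq\<close> are compared separately, before the substitution of the
        square.\<close>
      show ?thesis
        unfolding Pair unfolds
        by (intro arg_cong2[where f = "(+)"] arg_cong2[where f = "(*)"] arg_cong[where f = at_sq] refl
            poly_ext; simp add: field_simps)
    qed
    show "?f (S_n1_basis_act lam \<alpha> a (GG (0 + of_int j)) v) =
        Omega_R_basis_act lam (- (1/2) * a) (GG (0 + of_int j)) (?f v)" for j v
    proof (cases v)
      case (Pair g h)
      show ?thesis
        unfolding Pair unfolds add_Pair add_0_left add_0_right floor_of_int of_rat_of_int_eq inverse_sqrt_2
        using assms sqrt_2_squared
        by (intro arg_cong2[where f = "(+)"] arg_cong2[where f = "(*)"] arg_cong[where f = at_sq] refl
            poly_ext; simp add: k_def field_simps)
    qed
  qed (simp_all add: as_ramond_module_def pullback_def mod_C_def S_module_def Omega_R_def pair_scale_def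
      at_sq_add at_sq_smult smult_add_right algebra_simps)
  then show ?thesis by (simp add: k_def ramond_n1_def)
qed


text \<open>\<open>Upsilon1\<close> halves the even generators and doubles their indices;
  substituting \<open>2 * x\<close> for \<open>x\<close> undoes both, leaving
  \<open>lam powi (2 * m)\<close>, the source of the parameter \<open>lam\<^sup>2\<close>. The odd
  generators give \<open>k * \<alpha> / 2 = 1 / lam\<close> in one direction and
  \<open>k * lam = 2 / \<alpha>\<close> in the other, both solved by
  \<open>2 / (lam * \<alpha>)\<close>.\<close>

lemma S_iso_Omega_NS:
  assumes "lam \<noteq> 0" and "\<alpha> \<noteq> 0"
  shows "supermodule_iso neveu_schwarz_n1 (as_neveu_schwarz_module (S_module lam \<alpha> a))
    (Omega_NS (lam\<^sup>2) (- (1/2) * a))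
    (\<lambda>v. ((fst v :: complex poly) \<circ>\<^sub>p [:0, 2:], smult (2 / (lam * \<alpha>)) (snd v \<circ>\<^sub>p [:0, 2:])))"
proof -
  let ?M = "as_neveu_schwarz_module (S_module lam \<alpha> a)" and ?N = "Omega_NS (lam\<^sup>2) (- (1/2) * a)"
  define k where "k = 2 / (lam * \<alpha>)"
  let ?f = "\<lambda>v. ((fst v :: complex poly) \<circ>\<^sub>p [:0, 2:], smult k (snd v \<circ>\<^sub>p [:0, 2:]))"
  let ?A = "\<lambda>b v. case b of
       LL m \<Rightarrow> pair_scale (1/2) (S_n1_basis_act lam \<alpha> a (LL (2 * m)) v)
     | GG r \<Rightarrow> pair_scale (1 / of_real (sqrt 2)) (S_n1_basis_act lam \<alpha> a (GG (2 * r)) v)"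
  have k: "k \<noteq> 0" "k * (lam * \<alpha>) = 2" using assms by (simp_all add: k_def)
  have sqrt2: "of_real (sqrt 2) * (of_real (sqrt 2) * z) = 2 * z" for z :: complex
    using sqrt_2_squared by (simp flip: mult.assoc)
  have half: "p \<circ>\<^sub>p [:0, 1/2:] \<circ>\<^sub>p [:0, 2:] = p" "p \<circ>\<^sub>p [:0, 2:] \<circ>\<^sub>p [:0, 1/2:] = p" for p :: "complex poly"
    by (rule poly_ext; simp add: poly_pcompose)+
  have pcompose_eq_0: "p \<circ>\<^sub>p [:0, 2:] = 0 \<longleftrightarrow> p = 0" for p :: "complex poly"
    using half(2)[of p] by auto
  have pw: "lam\<^sup>2 powi m = lam powi (2 * m)" for m
    by (simp add: power_int_mult)
  have "supermodule_iso (n1_algebra (1/2)) ?M ?N ?f"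
  proof (rule n1_supermodule_isoI[where A = ?A and B = "Omega_NS_basis_act (lam\<^sup>2) (- (1/2) * a)"])
    show "is_supermodule (n1_algebra (1/2)) ?N"
      \<comment> \<open>The parameter is a square already, so \<open>lam\<close> itself serves as
        the root.\<close>
      using Omega_NS_iso_N1_module[OF assms(1)] by (simp add: supermodule_iso_def neveu_schwarz_n1_def)
    show "bij ?f"
      by (rule o_bij[where g = "\<lambda>v. ((fst v :: complex poly) \<circ>\<^sub>p [:0, 1/2:], smult (1 / k) (snd v \<circ>\<^sub>p [:0, 1/2:]))"])
        (use k in \<open>auto simp: fun_eq_iff half pcompose_smult\<close>)
    show "act ?M x v = lin_ext (scale ?M) (\<lambda>b. ?A b v) x" for x v
      using act_Upsilon2_Upsilon1
      by (simp add: as_neveu_schwarz_module_def pullback_def mod_C_def S_module_def)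
    show "(v \<in> part ?M p) = (?f v \<in> part ?N p)" for p v
      using k by (cases v) (auto simp: as_neveu_schwarz_module_def pullback_def mod_C_def S_module_def
          Omega_NS_def part_def pcompose_eq_0)
    note unfolds = S_n1_basis_act_def n1_basis.case S_basis_act.simps Omega_NS_basis_act.simps
      fst_conv snd_conv pair_scale_simp add_Pair add_0_left add_0_right pw floor_half prod.inject
    show "?f (?A (LL m) v) = Omega_NS_basis_act (lam\<^sup>2) (- (1/2) * a) (LL m) (?f v)" for m v
    proof (cases v)
      case (Pair g h)
      show ?thesis
        unfolding Pair unfolds by (intro conjI poly_ext; simp add: poly_pcompose field_simps)
    qed
    \<comment> \<open>The index \<open>1/2 + j\<close> is doubled to the odd integer
      \<open>2 * j + 1\<close> on the side of S, whereas the powers of \<open>lam\<^sup>2\<close> on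
      the other side are \<open>j + 1\<close> and \<open>j\<close>.\<close>
    show "?f (?A (GG (1/2 + of_int j)) v) =
        Omega_NS_basis_act (lam\<^sup>2) (- (1/2) * a) (GG (1/2 + of_int j)) (?f v)" for j v
    proof (cases v)
      case (Pair g h)
      have half_r: "(of_rat (1/2 + of_int j) :: complex) = 1/2 + of_int j"
        by (simp add: of_rat_add of_rat_divide)
      \<comment> \<open>The two roots, one from each homomorphism, multiply to 2 and disappear; only
        then are the denominators in \<open>k\<close> cleared.\<close>
      show ?thesis
        unfolding Pair unfolds half_r inverse_sqrt_2 using assms
        by (intro conjI poly_ext; simp add: poly_pcompose power_int_add algebra_simps sqrt2;
            simp add: k_def field_simps power2_eq_square)
    qed
  qed (simp_all add: as_neveu_schwarz_module_def pullback_def mod_C_def S_module_def Omega_NS_def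
      pair_scale_def pcompose_add pcompose_smult smult_add_right algebra_simps)
  then show ?thesis by (simp add: k_def neveu_schwarz_n1_def)
qed

theorem proposition3p18:
  fixes lam \<alpha> a :: complex
  assumes "lam \<noteq> 0" and "\<alpha> \<noteq> 0"
  shows "isomorphic_supermodules ramond_n1
           (as_ramond_module (S_module lam \<alpha> a)) (Omega_R lam (- (1/2) * a)) \<and>
         isomorphic_supermodules neveu_schwarz_n1
           (as_neveu_schwarz_module (S_module lam \<alpha> a)) (Omega_NS (lam\<^sup>2) (- (1/2) * a))"
  using S_iso_Omega_R[OF assms] S_iso_Omega_NS[OF assms]
  unfolding isomorphic_supermodules_def by blast

end
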